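(* Let $\Phi=\{\phi_1,\ldots,\phi_n\}$ be a finite set of compactly supported functions on $\mathbb{R}$, let $V_\Phi$ be the shift-invariant space generated by $\Phi$, and let $H\subset V_\Phi$ be the space of all analytic functions in $V_\Phi$. Then there exist $s\in\mathbb{N}$, complex numbers $\lambda_1,\ldots,\lambda_s$ (pairwise distinct modulo $2\pi i$) and $d_1,\ldots,d_s\in\mathbb{N}_0$ such that every $f\in H$ has the form $$f(t)=\sum_{j=1}^s e^{\lambda_j t}\sum_{k=0}^{d_j}\pi_{j,k}(t)\,t^k,\qquad t\in\mathbb{R},$$ for some $1$-periodic analytic functions $\pi_{j,k}:\mathbb{R}\to\mathbb{C}$, $k=0,\ldots,d_j$, $j=1,\ldots,s$. Moreover, $$\dim(H)\le\sum_{j=1}^n|\operatorname{supp}(\phi_j)|.$$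
   Context: The generators $\phi_j:\mathbb{R}\to\mathbb{C}$ are integrable with compact support. $\ell(\mathbb{Z})$ denotes the space of all sequences $c:\mathbb{Z}\to\mathbb{C}$. The shift-invariant space generated by $\Phi$ is $$V_\Phi=\operatorname{closure}\Bigl\{\sum_{j=1}^n\sum_{k\in\mathbb{Z}}c(j,k)\,\phi_j(\cdot-k)\ :\ c(j,\cdot)\in\ell(\mathbb{Z})\Bigr\},$$ the closure being taken in $L_{1,\mathrm{loc}}(\mathbb{R})$ (functions are identified if they agree almost everywhere). A function on $\mathbb{R}$ with values in $\mathbb{C}$ is called analytic if it is infinitely differentiable on $\mathbb{R}$ and has a power series expansion around each point of $\mathbb{R}$. "$1$-periodic" means $\pi(t+1)=\pi(t)$ for all $t\in\mathbb{R}$. $|\operatorname{supp}(\phi_j)|$ denotes the length (Lebesgue measure) of the support of $\phi_j$. *)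

theory Defs
  imports "HOL-Analysis.Analysis" "HOL-Library.Function_Algebras"
begin

(* Support of (the a.e.-class of) f: the complement of the largest open set on which f
   vanishes almost everywhere.  It only depends on the a.e.-class of f. *)
definition ess_support :: "(real \<Rightarrow> complex) \<Rightarrow> real set" where
  "ess_support f = - \<Union> {U. open U \<and> (AE t in lebesgue. t \<in> U \<longrightarrow> f t = 0)}"

lemma closed_ess_support: "closed (ess_support f)"
  unfolding ess_support_def by (intro closed_Compl open_Union ballI) simp

lemma ess_support_subset: "ess_support f \<subseteq> closure {t. f t \<noteq> 0}"
proof -
  let ?U = "- closure {t. f t \<noteq> 0}"
  have "t \<in> ?U \<longrightarrow> f t = 0" for t
    using closure_subset[of "{t. f t \<noteq> 0}"] by blast
  then have "AE t in lebesgue. t \<in> ?U \<longrightarrow> f t = 0"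
    by (rule AE_I2)
  then have "?U \<subseteq> \<Union> {U. open U \<and> (AE t in lebesgue. t \<in> U \<longrightarrow> f t = 0)}"
    by (intro Union_upper CollectI conjI open_Compl closed_closure)
  then show ?thesis
    unfolding ess_support_def by blast
qed

definition L1_loc :: "(real \<Rightarrow> complex) set" where
  "L1_loc = {f. \<forall>K. compact K \<longrightarrow> f absolutely_integrable_on K}"

(* The locally convex topology given by the seminorms "integral of |f| over K", K compact.
   Elements are functions, not a.e.-classes, so the topology is not Hausdorff:
   a.e.-equal functions are inseparable, and closed sets are unions of a.e.-classes. *)
definition L1_loc_topology :: "(real \<Rightarrow> complex) topology" where
  "L1_loc_topology = topology_generated_by
     {{g \<in> L1_loc. (LINT t:K|lebesgue. norm (g t - f t)) < \<epsilon>} | f K \<epsilon>.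
        f \<in> L1_loc \<and> compact K \<and> \<epsilon> > 0}"

(* For compactly supported generators, almost every t makes the inner series a sum with
   finitely many nonzero terms, so no condition on the coefficients is needed. *)
definition integer_shift_sums :: "nat \<Rightarrow> (nat \<Rightarrow> real \<Rightarrow> complex) \<Rightarrow> (real \<Rightarrow> complex) set" where
  "integer_shift_sums n \<phi> =
     {(\<lambda>t. \<Sum>j=1..n. \<Sum>\<^sub>\<infinity>k::int. c j k * \<phi> j (t - of_int k)) | c :: nat \<Rightarrow> int \<Rightarrow> complex. True}"

definition shift_invariant_space :: "nat \<Rightarrow> (nat \<Rightarrow> real \<Rightarrow> complex) \<Rightarrow> (real \<Rightarrow> complex) set" where
  "shift_invariant_space n \<phi> = L1_loc_topology closure_of integer_shift_sums n \<phi>"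

definition smooth_fun :: "(real \<Rightarrow> complex) \<Rightarrow> bool" where
  "smooth_fun f \<longleftrightarrow>
     (\<forall>m t. ((\<lambda>g x. vector_derivative g (at x)) ^^ m) f differentiable at t)"

definition analytic_fun :: "(real \<Rightarrow> complex) \<Rightarrow> bool" where
  "analytic_fun f \<longleftrightarrow> smooth_fun f \<and>
     (\<forall>x. \<exists>r>0. \<exists>a :: nat \<Rightarrow> complex.
        \<forall>t. \<bar>t - x\<bar> < r \<longrightarrow> (\<lambda>k. a k * of_real (t - x) ^ k) sums f t)"

definition cscale :: "complex \<Rightarrow> (real \<Rightarrow> complex) \<Rightarrow> real \<Rightarrow> complex" where
  "cscale c f = (\<lambda>t. c * f t)"

lemma vector_space_cscale: "vector_space cscale"
proof (rule vector_space.intro)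
  show "cscale a (x + y) = cscale a x + cscale a y" for a x y
    by (rule ext) (simp only: cscale_def plus_fun_apply distrib_left)
  show "cscale (a + b) x = cscale a x + cscale b x" for a b x
    by (rule ext) (simp only: cscale_def plus_fun_apply distrib_right)
  show "cscale a (cscale b x) = cscale (a * b) x" for a b x
    by (rule ext) (simp only: cscale_def mult.assoc)
  show "cscale 1 x = x" for x
    by (rule ext) (simp only: cscale_def mult_1_left)
qed

(* Provides cfun.span, cfun.dim etc. over the complex numbers. *)
interpretation cfun: vector_space cscale
  by (rule vector_space_cscale)

end

theory Submission
  imports Defs "HOL-Complex_Analysis.Complex_Analysis"
    "HOL-Computational_Algebra.Fundamental_Theorem_Algebra"
begin

text \<open>Let \<open>T\<close> be the translation operator \<open>(T f)(t) = f (t + 1)\<close>.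

  \<^bold>\<open>Dimension.\<close> Near a point \<open>a\<close> only those translates \<open>\<phi>\<^sub>j (t - k)\<close> matter for which \<open>a - k\<close> lies in the
  support of \<open>\<phi>\<^sub>j\<close>: since the supports are compact, all others vanish on a whole interval around \<open>a\<close>
  (\<open>avoided_translates_locally_avoided\<close>). The number of these pairs \<open>(j, k)\<close>, as a function of \<open>a\<close>, has
  integral \<open>\<Sum>\<^sub>j |supp \<phi>\<^sub>j|\<close> over the unit interval, so for some \<open>a\<close> it is at most this sum
  (\<open>exists_point_in_few_translates\<close>). On the resulting interval, every shift sum is almost everywhere a
  linear combination of so many fixed functions, and this survives the passage to the closure because
  finite-dimensional spans are closed (\<open>finite_span_closed_under_seminorm\<close>,
  \<open>shift_invariant_space_on_window\<close>). An analytic function is determined by its restriction to an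
  interval, up to a null set (\<open>analytic_fun_eq_0_if_AE\<close>). Hence the analytic functions with restriction
  in the finite-dimensional span form a space of at most that dimension (\<open>subspace_spanned_by_card\<close>).

  \<^bold>\<open>Form.\<close> The same bound holds for the space \<open>G\<close> of analytic functions \<open>f\<close> all of whose translates
  \<open>T\<^sup>m f\<close>, for natural \<open>m\<close>, agree almost everywhere on the interval with elements of that span. It contains the analytic functions in the
  shift-invariant space and is mapped into itself by \<open>T\<close>, so some nonzero polynomial \<open>p\<close> satisfies
  \<open>p(T) f = 0\<close> for all \<open>f\<close> in \<open>G\<close> (\<open>shift_invariant_finite_dim_annihilated\<close>). The exponents are the
  logarithms of the nonzero roots of \<open>p\<close>. Indeed, factoring \<open>p\<close> reduces \<open>p(T) f = 0\<close> to successive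
  equations \<open>(T - z) h = g\<close> with \<open>g\<close> an exponential polynomial with periodic analytic coefficients; such
  an equation has a solution of the same kind, of degree one higher if \<open>z\<close> already occurs in \<open>g\<close>
  (\<open>difference_equation_solvable\<close>), and two solutions differ by a periodic multiple of an exponential
  function (\<open>annihilated_by_shift_poly_imp_exp_poly\<close>).\<close>

section \<open>Real-analytic functions as restrictions of holomorphic functions\<close>

text \<open>This description of real-analyticity is visibly stable under derivatives, products and
  translations, and it gives access to the identity theorem for holomorphic functions.\<close>
definition locally_holomorphic :: "(real \<Rightarrow> complex) \<Rightarrow> bool" where
  "locally_holomorphic f \<longleftrightarrow> (\<forall>x. \<exists>r>0. \<exists>F. F holomorphic_on ball (of_real x) r \<and>
     (\<forall>t. \<bar>t - x\<bar> < r \<longrightarrow> f t = F (of_real t)))"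

lemma of_real_in_complex_ball_iff:
  "(of_real t :: complex) \<in> ball (of_real x) r \<longleftrightarrow> \<bar>t - x\<bar> < r"
  by (metis abs_minus_commute dist_of_real dist_real_def mem_ball)

text \<open>Smoothness follows by iteration: the derivative of the restriction of \<open>F\<close> to the line is the
  restriction of \<open>deriv F\<close>, hence of the same kind.\<close>
lemma locally_holomorphic_has_derivative:
  assumes "locally_holomorphic f"
  shows "f differentiable at t"
    and "locally_holomorphic (\<lambda>x. vector_derivative f (at x))"
proof -
  have *: "\<exists>r>0. \<exists>F. F holomorphic_on ball (of_real x) r \<and>
      (\<forall>t. \<bar>t - x\<bar> < r \<longrightarrow> (f has_vector_derivative deriv F (of_real t)) (at t))" for x
  proof -
    obtain r F where r: "r > 0" "F holomorphic_on ball (of_real x) r"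
      and F: "\<And>t. \<bar>t - x\<bar> < r \<Longrightarrow> f t = F (of_real t)"
      using assms unfolding locally_holomorphic_def by blast
    have "(f has_vector_derivative deriv F (of_real t)) (at t)" if t: "\<bar>t - x\<bar> < r" for t
    proof (rule has_vector_derivative_transform_within_open)
      show "((\<lambda>t. F (of_real t)) has_vector_derivative deriv F (of_real t)) (at t)"
        using holomorphic_derivI[OF r(2)] t
        by (intro has_vector_derivative_real_field) (auto simp del: mem_ball simp: of_real_in_complex_ball_iff)
      show "open (ball x r)" "t \<in> ball x r"
        using t by (auto simp: dist_real_def)
      show "\<And>s. s \<in> ball x r \<Longrightarrow> F (of_real s) = f s"
        using F by (auto simp: dist_real_def abs_minus_commute)
    qed
    with r show ?thesis by blast
  qed
  show "f differentiable at t"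
    using *[of t] by (metis abs_zero differentiableI_vector diff_self)
  show "locally_holomorphic (\<lambda>x. vector_derivative f (at x))"
    unfolding locally_holomorphic_def
  proof
    fix x
    obtain r F where r: "r > 0" "F holomorphic_on ball (of_real x) r"
      and F: "\<And>t. \<bar>t - x\<bar> < r \<Longrightarrow> (f has_vector_derivative deriv F (of_real t)) (at t)"
      using *[of x] by blast
    have "deriv F holomorphic_on ball (of_real x) r"
      using r by (intro holomorphic_deriv) auto
    moreover have "vector_derivative f (at t) = deriv F (of_real t)" if "\<bar>t - x\<bar> < r" for t
      using F[OF that] by (rule vector_derivative_at)
    ultimately show "\<exists>r>0. \<exists>F. F holomorphic_on ball (of_real x) r \<and>
        (\<forall>t. \<bar>t - x\<bar> < r \<longrightarrow> vector_derivative f (at t) = F (of_real t))"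
      using r(1) by blast
  qed
qed

text \<open>A power series that converges at the real points of an interval converges on the complex disc
  with the same centre and radius, so it extends the function holomorphically. Conversely, the
  Taylor series of a holomorphic extension is the required expansion.\<close>
lemma analytic_fun_iff: "analytic_fun f \<longleftrightarrow> locally_holomorphic f"
proof
  assume f: "locally_holomorphic f"
  have "locally_holomorphic (((\<lambda>g x. vector_derivative g (at x)) ^^ m) f)" for m
    by (induction m) (auto intro: f locally_holomorphic_has_derivative(2))
  then have "smooth_fun f"
    unfolding smooth_fun_def using locally_holomorphic_has_derivative(1) by blast
  moreover have "\<exists>r>0. \<exists>a :: nat \<Rightarrow> complex.
      \<forall>t. \<bar>t - x\<bar> < r \<longrightarrow> (\<lambda>k. a k * of_real (t - x) ^ k) sums f t" for x
  proof -
    obtain r F where r: "r > 0" "F holomorphic_on ball (of_real x) r"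
      and F: "\<And>t. \<bar>t - x\<bar> < r \<Longrightarrow> f t = F (of_real t)"
      using f unfolding locally_holomorphic_def by blast
    have "(\<lambda>k. (deriv ^^ k) F (of_real x) / fact k * of_real (t - x) ^ k) sums f t"
      if "\<bar>t - x\<bar> < r" for t
      using holomorphic_power_series[OF r(2), of "of_real t"] that F
      by (simp add: of_real_in_complex_ball_iff del: mem_ball)
    with r(1) show ?thesis
      by (intro exI[of _ r] conjI exI[of _ "\<lambda>k. (deriv ^^ k) F (of_real x) / fact k"] allI impI)
  qed
  ultimately show "analytic_fun f"
    unfolding analytic_fun_def by blast
next
  assume f: "analytic_fun f"
  show "locally_holomorphic f"
    unfolding locally_holomorphic_def
  proof
    fix x
    obtain r a where r: "r > 0"
      and a: "\<And>t. \<bar>t - x\<bar> < r \<Longrightarrow> (\<lambda>k. a k * of_real (t - x) ^ k) sums f t"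
      using f unfolding analytic_fun_def by blast
    define F where "F = (\<lambda>z :: complex. \<Sum>k. a k * (z - of_real x) ^ k)"
    have "(\<lambda>k. a k * (z - of_real x) ^ k) sums F z" if "z \<in> ball (of_real x) r" for z
    proof -
      have "norm (z - of_real x) < r"
        using that by (simp add: dist_norm norm_minus_commute)
      then obtain \<rho> where \<rho>: "norm (z - of_real x) < \<rho>" "\<rho> < r"
        using dense by blast
      then have "\<rho> > 0"
        by (meson norm_ge_zero order_le_less_trans)
      have "summable (\<lambda>k. a k * of_real \<rho> ^ k)"
        using a[of "x + \<rho>"] \<rho> \<open>\<rho> > 0\<close> by (simp add: sums_iff)
      moreover have "norm (z - of_real x) < norm (of_real \<rho> :: complex)"
        using \<rho> \<open>\<rho> > 0\<close> by simp
      ultimately have "summable (\<lambda>k. a k * (z - of_real x) ^ k)"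
        by (rule powser_inside)
      then show ?thesis
        unfolding F_def by (rule summable_sums)
    qed
    then have "F holomorphic_on ball (of_real x) r"
      by (rule power_series_holomorphic)
    moreover have "f t = F (of_real t)" if "\<bar>t - x\<bar> < r" for t
      using a[OF that] unfolding F_def by (simp add: sums_iff)
    ultimately show "\<exists>r>0. \<exists>F. F holomorphic_on ball (of_real x) r \<and>
        (\<forall>t. \<bar>t - x\<bar> < r \<longrightarrow> f t = F (of_real t))"
      using r by blast
  qed
qed

lemma analytic_fun_continuous: "analytic_fun f \<Longrightarrow> continuous_on A f"
  unfolding analytic_fun_iff
  by (meson continuous_at_imp_continuous_on differentiable_imp_continuous_within
      locally_holomorphic_has_derivative(1))

lemma analytic_fun_combine:
  assumes f: "analytic_fun f" and g: "analytic_fun g"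
    and op: "\<And>F G S. F holomorphic_on S \<Longrightarrow> G holomorphic_on S \<Longrightarrow> (\<lambda>z. h (F z) (G z)) holomorphic_on S"
  shows "analytic_fun (\<lambda>t. h (f t) (g t))"
  unfolding analytic_fun_iff locally_holomorphic_def
proof
  fix x
  obtain r F where F: "r > 0" "F holomorphic_on ball (of_real x) r"
      "\<And>t. \<bar>t - x\<bar> < r \<Longrightarrow> f t = F (of_real t)"
    using f unfolding analytic_fun_iff locally_holomorphic_def by blast
  obtain s G where G: "s > 0" "G holomorphic_on ball (of_real x) s"
      "\<And>t. \<bar>t - x\<bar> < s \<Longrightarrow> g t = G (of_real t)"
    using g unfolding analytic_fun_iff locally_holomorphic_def by blast
  have "(\<lambda>z. h (F z) (G z)) holomorphic_on ball (of_real x) (min r s)"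
    by (intro op holomorphic_on_subset[OF F(2)] holomorphic_on_subset[OF G(2)]) auto
  then show "\<exists>r>0. \<exists>F. F holomorphic_on ball (of_real x) r \<and>
      (\<forall>t. \<bar>t - x\<bar> < r \<longrightarrow> h (f t) (g t) = F (of_real t))"
    using F(1,3) G(1,3)
    by (intro exI[of _ "min r s"] conjI exI[of _ "\<lambda>z. h (F z) (G z)"]) auto
qed

lemma analytic_fun_add: "analytic_fun f \<Longrightarrow> analytic_fun g \<Longrightarrow> analytic_fun (\<lambda>t. f t + g t)"
  by (rule analytic_fun_combine) (assumption | rule holomorphic_on_add)+

lemma analytic_fun_mult: "analytic_fun f \<Longrightarrow> analytic_fun g \<Longrightarrow> analytic_fun (\<lambda>t. f t * g t)"
  by (rule analytic_fun_combine) (assumption | rule holomorphic_on_mult)+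

lemma analytic_fun_entire:
  assumes "F holomorphic_on UNIV"
  shows "analytic_fun (\<lambda>t. F (of_real t))"
  unfolding analytic_fun_iff locally_holomorphic_def
  using holomorphic_on_subset[OF assms] by (metis subset_UNIV zero_less_one)

lemma analytic_fun_const: "analytic_fun (\<lambda>t. c)"
  using analytic_fun_entire[of "\<lambda>z. c"] by simp

lemma analytic_fun_cmult: "analytic_fun f \<Longrightarrow> analytic_fun (\<lambda>t. c * f t)"
  by (rule analytic_fun_mult[OF analytic_fun_const])

lemma analytic_fun_shift:
  assumes "analytic_fun f"
  shows "analytic_fun (\<lambda>t. f (t + c))"
  unfolding analytic_fun_iff locally_holomorphic_def
proof
  fix x
  obtain r F where F: "r > 0" "F holomorphic_on ball (of_real (x + c)) r"
      "\<And>t. \<bar>t - (x + c)\<bar> < r \<Longrightarrow> f t = F (of_real t)"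
    using assms unfolding analytic_fun_iff locally_holomorphic_def by blast
  have "(F \<circ> (\<lambda>z. z + of_real c)) holomorphic_on ball (of_real x) r"
    by (rule holomorphic_on_compose_gen[OF _ F(2)])
       (auto intro!: holomorphic_intros simp: dist_norm algebra_simps)
  moreover have "f (t + c) = (F \<circ> (\<lambda>z. z + of_real c)) (of_real t)" if "\<bar>t - x\<bar> < r" for t
    using F(3)[of "t + c"] that by simp
  ultimately show "\<exists>r>0. \<exists>F. F holomorphic_on ball (of_real x) r \<and>
      (\<forall>t. \<bar>t - x\<bar> < r \<longrightarrow> f (t + c) = F (of_real t))"
    using F(1) by blast
qed

text \<open>The interior of the zero set is open by construction and closed because the zeros that
  accumulate at a point of its closure force the local holomorphic extension there to vanish.
  The line is connected.\<close>
lemma analytic_fun_identity: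
  assumes f: "analytic_fun f" and "\<delta> > 0" and zero: "\<And>t. \<bar>t - a\<bar> < \<delta> \<Longrightarrow> f t = 0"
  shows "f t = 0"
proof -
  define A where "A = {x. \<exists>e>0. \<forall>t. \<bar>t - x\<bar> < e \<longrightarrow> f t = 0}"
  have "open A"
    unfolding open_dist
  proof (intro ballI)
    fix x assume "x \<in> A"
    then obtain e where e: "e > 0" "\<And>t. \<bar>t - x\<bar> < e \<Longrightarrow> f t = 0"
      unfolding A_def by blast
    have "f t = 0" if "dist y x < e / 2" "\<bar>t - y\<bar> < e / 2" for y t
      using that by (intro e(2)) (unfold dist_real_def, linarith)
    then have "y \<in> A" if "dist y x < e / 2" for y
      unfolding A_def using e(1) that by (blast intro: half_gt_zero)
    then show "\<exists>e>0. \<forall>y. dist y x < e \<longrightarrow> y \<in> A"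
      using e(1) by (meson half_gt_zero)
  qed
  moreover have "closure A \<subseteq> A"
  proof
    fix x assume "x \<in> closure A"
    then have x: "\<forall>e>0. \<exists>y\<in>A. dist y x < e"
      by (simp add: closure_approachable)
    obtain r F where F: "r > 0" "F holomorphic_on ball (of_real x) r"
        "\<And>t. \<bar>t - x\<bar> < r \<Longrightarrow> f t = F (of_real t)"
      using f unfolding analytic_fun_iff locally_holomorphic_def by blast
    obtain y where y: "y \<in> A" "dist y x < r"
      using x F(1) by blast
    then obtain e where e: "e > 0" "\<And>t. \<bar>t - y\<bar> < e \<Longrightarrow> f t = 0"
      unfolding A_def by blast
    define e' where "e' = min e (r - dist y x)"
    have e': "e' > 0" using e(1) y(2) by (simp add: e'_def)
    define U :: "complex set" where "U = of_real ` ball y e'"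
    have "\<bar>t - x\<bar> < r" "f t = 0" if "t \<in> ball y e'" for t
    proof -
      have t: "\<bar>t - y\<bar> < e" "\<bar>t - y\<bar> < r - dist y x"
        using that by (simp_all add: e'_def dist_real_def abs_minus_commute)
      then show "f t = 0" by (intro e(2))
      show "\<bar>t - x\<bar> < r" using t(2) unfolding dist_real_def by linarith
    qed
    then have U: "U \<subseteq> ball (of_real x) r" "\<And>z. z \<in> U \<Longrightarrow> F z = 0"
      unfolding U_def image_subset_iff of_real_in_complex_ball_iff
      using F(3) by (blast, metis imageE)
    have "y islimpt ball y e'"
      using e' by (simp add: islimpt_ball)
    then have lim: "of_real y islimpt U"
      unfolding U_def islimpt_approachable
      by (metis dist_of_real image_eqI of_real_eq_iff)
    have "F z = 0" if "z \<in> ball (of_real x) r" for z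
      using y(2) that
      by (intro analytic_continuation[OF F(2) open_ball connected_ball U(1) _ lim U(2)])
         (auto simp: dist_of_real dist_commute)
    then have "\<forall>t. \<bar>t - x\<bar> < r \<longrightarrow> f t = 0"
      using F(3) of_real_in_complex_ball_iff by auto
    then show "x \<in> A"
      unfolding A_def using F(1) by blast
  qed
  moreover have "a \<in> A"
    using assms(2) zero unfolding A_def by blast
  ultimately have "A = UNIV"
    using clopen[of A] closure_subset_eq[of A] by blast
  then have "t \<in> A" by simp
  then show ?thesis
    unfolding A_def by fastforce
qed

text \<open>Continuity turns vanishing almost everywhere on an interval into vanishing
  everywhere on it, since a nonempty open set is not negligible.\<close>

lemma analytic_fun_eq_0_if_AE:
  assumes f: "analytic_fun f" and "\<delta> > 0" and ae: "AE t in lebesgue. t \<in> cball a \<delta> \<longrightarrow> f t = 0"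
  shows "f = (\<lambda>t. 0)"
proof -
  define U where "U = {t \<in> ball a \<delta>. f t \<in> - {0}}"
  have "open U"
    using continuous_open_preimage[OF analytic_fun_continuous[OF f] open_ball, of "- {0}" a \<delta>]
    by (simp add: U_def vimage_def Int_def open_Compl)
  obtain N where "negligible N" "{t. \<not> (t \<in> cball a \<delta> \<longrightarrow> f t = 0)} \<subseteq> N"
    using ae unfolding eventually_ae_filter_negligible by blast
  then have "negligible U"
    by (elim negligible_subset) (auto simp: U_def)
  then have "U = {}"
    using open_not_negligible \<open>open U\<close> by blast
  then have "f t = 0" if "\<bar>t - a\<bar> < \<delta>" for t
    using that unfolding U_def by (auto simp: dist_real_def abs_minus_commute)
  then show ?thesis
    using analytic_fun_identity[OF f \<open>\<delta> > 0\<close>] by blast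
qed

section \<open>Linear difference equations with constant coefficients\<close>

lemma sum_fun_at: "(\<Sum>i\<in>A. F i) t = (\<Sum>i\<in>A. F i (t :: real) :: complex)"
  by (induction A rule: infinite_finite_induct) auto

definition periodic_analytic :: "(real \<Rightarrow> complex) set" where
  "periodic_analytic = {p. analytic_fun p \<and> (\<forall>t. p (t + 1) = p t)}"

text \<open>Exponents are encoded by their exponentials: \<open>z\<close> stands for the exponent \<open>Ln z\<close>. Nothing is lost,
  because exponents with equal exponentials differ by a multiple of \<open>2 pi i\<close>, and the quotient of
  the two exponential functions is then periodic and can be absorbed into the coefficients. A common
  degree bound \<open>D\<close> for all exponents keeps the families closed under sums. Since \<open>Ln 0\<close> is a
  default value, the results on difference equations require \<open>0 \<notin> Z\<close>.\<close>
definition exp_poly_space :: "complex set \<Rightarrow> nat \<Rightarrow> (real \<Rightarrow> complex) set" where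
  "exp_poly_space Z D = {f. \<exists>\<pi>. (\<forall>z k. \<pi> z k \<in> periodic_analytic) \<and>
     f = (\<lambda>t. \<Sum>z\<in>Z. exp (Ln z * of_real t) * (\<Sum>k=0..D. \<pi> z k t * of_real t ^ k))}"

lemma periodic_analytic_0: "(\<lambda>t. 0) \<in> periodic_analytic"
  unfolding periodic_analytic_def by (simp add: analytic_fun_const)

lemma subspace_exp_poly_space: "cfun.subspace (exp_poly_space Z D)"
proof (rule cfun.subspaceI)
  show "0 \<in> exp_poly_space Z D"
    unfolding exp_poly_space_def mem_Collect_eq
    by (rule exI[of _ "\<lambda>z k t. 0"]) (auto simp: periodic_analytic_0)
next
  fix f g assume "f \<in> exp_poly_space Z D" "g \<in> exp_poly_space Z D"
  then obtain \<pi> \<sigma> where "\<And>z k. \<pi> z k \<in> periodic_analytic" "\<And>z k. \<sigma> z k \<in> periodic_analytic"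
    and "f = (\<lambda>t. \<Sum>z\<in>Z. exp (Ln z * of_real t) * (\<Sum>k=0..D. \<pi> z k t * of_real t ^ k))"
    and "g = (\<lambda>t. \<Sum>z\<in>Z. exp (Ln z * of_real t) * (\<Sum>k=0..D. \<sigma> z k t * of_real t ^ k))"
    unfolding exp_poly_space_def by blast
  then show "f + g \<in> exp_poly_space Z D"
    unfolding exp_poly_space_def mem_Collect_eq
    by (intro exI[of _ "\<lambda>z k t. \<pi> z k t + \<sigma> z k t"])
       (auto simp: periodic_analytic_def analytic_fun_add sum.distrib distrib_left distrib_right)
next
  fix c f assume "f \<in> exp_poly_space Z D"
  then obtain \<pi> where "\<And>z k. \<pi> z k \<in> periodic_analytic"
    and "f = (\<lambda>t. \<Sum>z\<in>Z. exp (Ln z * of_real t) * (\<Sum>k=0..D. \<pi> z k t * of_real t ^ k))"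
    unfolding exp_poly_space_def by blast
  then show "cscale c f \<in> exp_poly_space Z D"
    unfolding exp_poly_space_def mem_Collect_eq
    by (intro exI[of _ "\<lambda>z k t. c * \<pi> z k t"])
       (auto simp: periodic_analytic_def analytic_fun_cmult cscale_def sum_distrib_left mult_ac)
qed

lemma exp_poly_space_mono:
  assumes "finite Z'" "Z \<subseteq> Z'" "D \<le> D'"
  shows "exp_poly_space Z D \<subseteq> exp_poly_space Z' D'"
proof
  fix f assume "f \<in> exp_poly_space Z D"
  then obtain \<pi> where \<pi>: "\<And>z k. \<pi> z k \<in> periodic_analytic"
    and f: "f = (\<lambda>t. \<Sum>z\<in>Z. exp (Ln z * of_real t) * (\<Sum>k=0..D. \<pi> z k t * of_real t ^ k))"
    unfolding exp_poly_space_def by blast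
  define \<sigma> where "\<sigma> = (\<lambda>z k. if z \<in> Z \<and> k \<le> D then \<pi> z k else (\<lambda>t. 0))"
  have "\<sigma> z k \<in> periodic_analytic" for z k
    unfolding \<sigma>_def using \<pi> periodic_analytic_0 by simp
  moreover have "(\<Sum>z\<in>Z'. exp (Ln z * of_real t) * (\<Sum>k=0..D'. \<sigma> z k t * of_real t ^ k)) =
      (\<Sum>z\<in>Z. exp (Ln z * of_real t) * (\<Sum>k=0..D. \<pi> z k t * of_real t ^ k))" for t
  proof (rule sum.mono_neutral_cong_right[OF assms(1,2)])
    show "\<forall>z\<in>Z' - Z. exp (Ln z * of_real t) * (\<Sum>k=0..D'. \<sigma> z k t * of_real t ^ k) = 0"
      by (simp add: \<sigma>_def)
    fix z assume "z \<in> Z"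
    then have "(\<Sum>k=0..D'. \<sigma> z k t * of_real t ^ k) = (\<Sum>k=0..D. \<pi> z k t * of_real t ^ k)"
      using assms(3) by (intro sum.mono_neutral_cong_right) (auto simp: \<sigma>_def)
    then show "exp (Ln z * of_real t) * (\<Sum>k=0..D'. \<sigma> z k t * of_real t ^ k) =
        exp (Ln z * of_real t) * (\<Sum>k=0..D. \<pi> z k t * of_real t ^ k)"
      by simp
  qed
  ultimately show "f \<in> exp_poly_space Z' D'"
    unfolding exp_poly_space_def f mem_Collect_eq by (intro exI[of _ \<sigma>]) auto
qed

lemma exp_poly_monomial_in_space:
  assumes "finite Z" "w \<in> Z" "k \<le> D" "p \<in> periodic_analytic"
  shows "(\<lambda>t. exp (Ln w * of_real t) * (p t * of_real t ^ k)) \<in> exp_poly_space Z D"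
proof -
  define \<pi> where "\<pi> = (\<lambda>z i. if z = w \<and> i = k then p else (\<lambda>t. 0))"
  have "(\<Sum>z\<in>Z. exp (Ln z * of_real t) * (\<Sum>i=0..D. \<pi> z i t * of_real t ^ i)) =
      exp (Ln w * of_real t) * (p t * of_real t ^ k)" for t
  proof -
    have "(\<Sum>i=0..D. \<pi> z i t * of_real t ^ i) = (if z = w then p t * of_real t ^ k else 0)" for z
    proof -
      have "(\<Sum>i=0..D. \<pi> z i t * of_real t ^ i) =
          (\<Sum>i=0..D. if k = i then if z = w then p t * of_real t ^ i else 0 else 0)"
        by (intro sum.cong) (auto simp: \<pi>_def)
      then show ?thesis using assms(3) by (simp add: sum.delta)
    qed
    then have "(\<Sum>z\<in>Z. exp (Ln z * of_real t) * (\<Sum>i=0..D. \<pi> z i t * of_real t ^ i)) =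
       (\<Sum>z\<in>Z. if w = z then exp (Ln z * of_real t) * (p t * of_real t ^ k) else 0)"
      by (intro sum.cong) auto
    then show ?thesis using assms(1,2) by (simp add: sum.delta)
  qed
  moreover have "\<pi> z i \<in> periodic_analytic" for z i
    unfolding \<pi>_def using assms(4) periodic_analytic_0 by simp
  ultimately show ?thesis
    unfolding exp_poly_space_def mem_Collect_eq by (intro exI[of _ \<pi>]) auto
qed

lemma analytic_fun_sum:
  "(\<And>i. i \<in> A \<Longrightarrow> analytic_fun (f i)) \<Longrightarrow> analytic_fun (\<lambda>t. \<Sum>i\<in>A. f i t)"
  by (induction A rule: infinite_finite_induct) (auto intro: analytic_fun_const analytic_fun_add)

lemma exp_poly_space_analytic:
  assumes "f \<in> exp_poly_space Z D"
  shows "analytic_fun f"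
proof -
  obtain \<pi> where "\<And>z k. \<pi> z k \<in> periodic_analytic"
    and f: "f = (\<lambda>t. \<Sum>z\<in>Z. exp (Ln z * of_real t) * (\<Sum>k=0..D. \<pi> z k t * of_real t ^ k))"
    using assms unfolding exp_poly_space_def by blast
  then have "analytic_fun (\<pi> z k)" for z k
    by (auto simp: periodic_analytic_def)
  moreover have "analytic_fun (\<lambda>t. exp (Ln z * of_real t))" "analytic_fun (\<lambda>t. of_real t ^ k)" for z k
    by (rule analytic_fun_entire; intro holomorphic_intros)+
  ultimately show ?thesis
    unfolding f by (intro analytic_fun_sum analytic_fun_mult) auto
qed

text \<open>The difference operator sends a suitably normalised monomial to the prescribed right-hand side
  plus terms of lower degree in \<open>t\<close>; those are removed by induction on the degree.\<close>
lemma difference_equation_solvable_monomial: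
  assumes Z: "finite Z" "w \<in> Z" "w \<noteq> 0" and z: "z \<noteq> 0" and p: "p \<in> periodic_analytic"
  shows "k \<le> D \<Longrightarrow> \<exists>h\<in>exp_poly_space Z (Suc D).
    \<forall>t. h (t + 1) - z * h t = exp (Ln w * of_real t) * (p t * of_real t ^ k)"
proof (induction k rule: less_induct)
  case (less k)
  define E where "E = (\<lambda>t. exp (Ln w * of_real t) * p t)"
  have E: "E (t + 1) = w * E t" for t
    using p Z(3) by (simp add: E_def periodic_analytic_def distrib_left exp_add)
  have mono: "(\<lambda>t. c * (E t * of_real t ^ i)) \<in> exp_poly_space Z (Suc D)" if "i \<le> Suc D" for c i
    using cfun.subspace_scale[OF subspace_exp_poly_space
        exp_poly_monomial_in_space[OF Z(1,2) that p], of c]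
    by (simp add: E_def cscale_def mult.assoc)
  have binom: "of_real (t + 1) ^ m = of_real t ^ m + (\<Sum>i<m. of_nat (m choose i) * of_real t ^ i :: complex)"
    for t m
    using binomial_ring[of "of_real t :: complex" 1 m]
    by (simp add: lessThan_Suc_atMost[symmetric])
  \<comment> \<open>At resonance \<open>w = z\<close> the operator lowers the degree by one, so the ansatz has to be
    one degree higher.\<close>
  obtain h0 a where h0: "h0 \<in> exp_poly_space Z (Suc D)"
    and step: "\<And>t. h0 (t + 1) - z * h0 t = E t * of_real t ^ k + (\<Sum>i<k. a i * (E t * of_real t ^ i))"
  proof (cases "w = z")
    case False
    define c where "c = 1 / (w - z)"
    have c: "c * (w - z) = 1" using False by (simp add: c_def)
    show ?thesis
    proof (rule that[of "\<lambda>t. c * (E t * of_real t ^ k)" "\<lambda>i. c * w * of_nat (k choose i)"])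
      show "(\<lambda>t. c * (E t * of_real t ^ k)) \<in> exp_poly_space Z (Suc D)"
        using less.prems by (intro mono) simp
      fix t
      have "c * (E (t + 1) * of_real (t + 1) ^ k) - z * (c * (E t * of_real t ^ k)) =
          c * (w - z) * (E t * of_real t ^ k) +
          c * w * E t * (\<Sum>i<k. of_nat (k choose i) * of_real t ^ i)"
        unfolding E binom by (simp add: algebra_simps)
      then show "c * (E (t + 1) * of_real (t + 1) ^ k) - z * (c * (E t * of_real t ^ k)) =
          E t * of_real t ^ k + (\<Sum>i<k. c * w * of_nat (k choose i) * (E t * of_real t ^ i))"
        unfolding c by (simp add: sum_distrib_left mult_ac)
    qed
  next
    case True
    define c where "c = 1 / (z * of_nat (Suc k))"
    have c: "c * z * of_nat (Suc k) = 1" using z by (simp add: c_def del: of_nat_Suc)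
    show ?thesis
    proof (rule that[of "\<lambda>t. c * (E t * of_real t ^ Suc k)" "\<lambda>i. c * z * of_nat (Suc k choose i)"])
      show "(\<lambda>t. c * (E t * of_real t ^ Suc k)) \<in> exp_poly_space Z (Suc D)"
        using less.prems by (intro mono) simp
      fix t
      have "c * (E (t + 1) * of_real (t + 1) ^ Suc k) - z * (c * (E t * of_real t ^ Suc k)) =
          c * z * E t * (\<Sum>i<Suc k. of_nat (Suc k choose i) * of_real t ^ i)"
        unfolding E binom True by (simp add: algebra_simps)
      also have "\<dots> = c * z * of_nat (Suc k) * (E t * of_real t ^ k) +
          c * z * E t * (\<Sum>i<k. of_nat (Suc k choose i) * of_real t ^ i)"
        by (simp add: algebra_simps)
      finally show "c * (E (t + 1) * of_real (t + 1) ^ Suc k) - z * (c * (E t * of_real t ^ Suc k)) =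
          E t * of_real t ^ k + (\<Sum>i<k. c * z * of_nat (Suc k choose i) * (E t * of_real t ^ i))"
        unfolding c by (simp only: sum_distrib_left mult_ac mult_1_left)
    qed
  qed
  have "\<exists>h. h \<in> exp_poly_space Z (Suc D) \<and> (\<forall>t. h (t + 1) - z * h t = E t * of_real t ^ i)"
    if "i < k" for i
    using less.IH[OF that] less.prems that by (auto simp: E_def mult.assoc)
  then obtain hh where hh: "\<And>i. i < k \<Longrightarrow> hh i \<in> exp_poly_space Z (Suc D)"
    "\<And>i t. i < k \<Longrightarrow> hh i (t + 1) - z * hh i t = E t * of_real t ^ i"
    by metis
  define h where "h = h0 - (\<Sum>i<k. cscale (a i) (hh i))"
  have "h \<in> exp_poly_space Z (Suc D)"
    unfolding h_def using h0 hh(1)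
    by (intro cfun.subspace_diff cfun.subspace_sum cfun.subspace_scale subspace_exp_poly_space) auto
  moreover have "h (t + 1) - z * h t = exp (Ln w * of_real t) * (p t * of_real t ^ k)" for t
  proof -
    have "h (t + 1) - z * h t =
        (h0 (t + 1) - z * h0 t) - (\<Sum>i<k. a i * (hh i (t + 1) - z * hh i t))"
      unfolding h_def
      by (simp add: sum_fun_at cscale_def right_diff_distrib sum_subtractf sum_distrib_left mult_ac)
    also have "(\<Sum>i<k. a i * (hh i (t + 1) - z * hh i t)) = (\<Sum>i<k. a i * (E t * of_real t ^ i))"
      by (intro sum.cong) (auto simp: hh(2))
    finally show ?thesis
      unfolding step by (simp add: E_def mult.assoc)
  qed
  ultimately show ?case by blast
qed

lemma difference_equation_solvable:
  assumes Z: "finite Z" "0 \<notin> Z" and z: "z \<noteq> 0" and g: "g \<in> exp_poly_space Z D"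
  shows "\<exists>h\<in>exp_poly_space Z (Suc D). \<forall>t. h (t + 1) - z * h t = g t"
proof -
  obtain \<pi> where \<pi>: "\<And>z k. \<pi> z k \<in> periodic_analytic"
    and g: "g = (\<lambda>t. \<Sum>z\<in>Z. exp (Ln z * of_real t) * (\<Sum>k=0..D. \<pi> z k t * of_real t ^ k))"
    using g unfolding exp_poly_space_def by blast
  have "\<exists>h. h \<in> exp_poly_space Z (Suc D) \<and>
      (\<forall>t. h (t + 1) - z * h t = exp (Ln w * of_real t) * (\<pi> w k t * of_real t ^ k))"
    if "w \<in> Z" "k \<le> D" for w k
    using difference_equation_solvable_monomial[OF Z(1) that(1) _ z \<pi> that(2)] that Z(2) by blast
  then obtain hh where hh: "\<And>w k. w \<in> Z \<Longrightarrow> k \<le> D \<Longrightarrow> hh w k \<in> exp_poly_space Z (Suc D)"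
    "\<And>w k t. w \<in> Z \<Longrightarrow> k \<le> D \<Longrightarrow> hh w k (t + 1) - z * hh w k t =
       exp (Ln w * of_real t) * (\<pi> w k t * of_real t ^ k)"
    by metis
  define h where "h = (\<Sum>w\<in>Z. \<Sum>k=0..D. hh w k)"
  have "h \<in> exp_poly_space Z (Suc D)"
    unfolding h_def using hh(1) by (intro cfun.subspace_sum subspace_exp_poly_space) auto
  moreover have "h (t + 1) - z * h t = g t" for t
  proof -
    have "h (t + 1) - z * h t = (\<Sum>w\<in>Z. \<Sum>k=0..D. hh w k (t + 1) - z * hh w k t)"
      unfolding h_def by (simp add: sum_fun_at sum_subtractf sum_distrib_left)
    also have "\<dots> = (\<Sum>w\<in>Z. \<Sum>k=0..D. exp (Ln w * of_real t) * (\<pi> w k t * of_real t ^ k))"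
      by (intro sum.cong) (auto simp: hh(2))
    finally show ?thesis
      unfolding g by (simp add: sum_distrib_left)
  qed
  ultimately show ?thesis by blast
qed

text \<open>This is \<open>p(T) f\<close> for the translation operator \<open>(T f)(t) = f (t + 1)\<close>.\<close>
definition poly_shift :: "complex poly \<Rightarrow> (real \<Rightarrow> complex) \<Rightarrow> real \<Rightarrow> complex" where
  "poly_shift p f = (\<lambda>t. \<Sum>i\<le>degree p. coeff p i * f (t + of_nat i))"

lemma poly_shift_upto:
  "degree p \<le> n \<Longrightarrow> poly_shift p f t = (\<Sum>i\<le>n. coeff p i * f (t + of_nat i))"
  unfolding poly_shift_def by (intro sum.mono_neutral_left) (auto simp: coeff_eq_0)

lemma poly_shift_pCons:
  "poly_shift (pCons a p) f t = a * f t + poly_shift p (\<lambda>t. f (t + 1)) t"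
  using poly_shift_upto[of "pCons a p" "Suc (degree p)" f t]
  by (simp add: degree_pCons_le sum.atMost_Suc_shift poly_shift_def add_ac del: sum.atMost_Suc)

lemma poly_shift_add: "poly_shift (p + q) f t = poly_shift p f t + poly_shift q f t"
  using poly_shift_upto[of "p + q" "max (degree p) (degree q)" f t]
    poly_shift_upto[of p "max (degree p) (degree q)" f t]
    poly_shift_upto[of q "max (degree p) (degree q)" f t]
  by (simp add: degree_add_le_max sum.distrib distrib_right)

lemma poly_shift_smult: "poly_shift (smult c p) f t = c * poly_shift p f t"
  using poly_shift_upto[of "smult c p" "degree p" f t]
  by (simp add: poly_shift_def sum_distrib_left mult.assoc degree_smult_le)

lemma poly_shift_mult: "poly_shift (p * q) f = poly_shift p (poly_shift q f)"
proof (induction p arbitrary: f)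
  case 0
  then show ?case by (simp add: poly_shift_def)
next
  case (pCons a p)
  have "poly_shift q (\<lambda>t. f (t + 1)) = (\<lambda>t. poly_shift q f (t + 1))"
    by (simp add: poly_shift_def add_ac)
  then show ?case
    by (intro ext) (simp add: poly_shift_add poly_shift_smult poly_shift_pCons pCons.IH)
qed

lemma poly_shift_linear: "poly_shift [:- z, 1:] f t = f (t + 1) - z * f t"
  by (simp add: poly_shift_def)

lemma analytic_fun_poly_shift: "analytic_fun f \<Longrightarrow> analytic_fun (poly_shift p f)"
  unfolding poly_shift_def by (intro analytic_fun_sum analytic_fun_cmult analytic_fun_shift)

text \<open>Induction on the degree, splitting off a root \<open>z\<close> of \<open>p\<close>. By induction \<open>g = (T - z) f\<close> has the
  asserted form, and \<open>(T - z) h = g\<close> is solvable by some \<open>h\<close> of that form. The difference \<open>f - h\<close>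
  is multiplied by \<open>z\<close> under translation, so it is a periodic multiple of \<open>exp (Ln z * t)\<close>.\<close>
lemma annihilated_by_shift_poly_imp_exp_poly:
  assumes "p \<noteq> 0"
  shows "\<exists>Z D. finite Z \<and> 0 \<notin> Z \<and>
    (\<forall>f. analytic_fun f \<longrightarrow> poly_shift p f = (\<lambda>t. 0) \<longrightarrow> f \<in> exp_poly_space Z D)"
  using assms
proof (induction "degree p" arbitrary: p)
  case 0
  then obtain c where p: "p = [:c:]" "c \<noteq> 0"
    by (metis degree_eq_zeroE pCons_0_0)
  have "f \<in> exp_poly_space {} 0" if "poly_shift p f = (\<lambda>t. 0)" for f
  proof -
    have "f = 0"
      using that p by (auto simp: poly_shift_def fun_eq_iff)
    then show ?thesis
      using cfun.subspace_0[OF subspace_exp_poly_space] by simp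
  qed
  then show ?case by blast
next
  case (Suc n)
  obtain z where "poly p z = 0"
    using Fundamental_Theorem_Algebra.fundamental_theorem_of_algebra[of p] Suc.hyps(2) by (auto simp: constant_degree)
  then obtain q where p: "p = [:- z, 1:] * q"
    unfolding poly_eq_0_iff_dvd by (auto simp: dvd_def)
  have q: "q \<noteq> 0" using p Suc.prems by auto
  then have "n = degree q"
    using Suc.hyps(2) unfolding p by (subst (asm) degree_mult_eq) auto
  then obtain Z D where Z: "finite Z" "0 \<notin> Z"
    and IH: "\<And>f. analytic_fun f \<Longrightarrow> poly_shift q f = (\<lambda>t. 0) \<Longrightarrow> f \<in> exp_poly_space Z D"
    using Suc.hyps(1) q by blast
  show ?case
  proof (cases "z = 0")
    case True
    \<comment> \<open>A root \<open>0\<close> contributes nothing, because translation is injective on functions on the line.\<close>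
    have "f \<in> exp_poly_space Z D" if f: "analytic_fun f" "poly_shift p f = (\<lambda>t. 0)" for f
    proof (rule IH[OF f(1)], rule ext)
      fix t
      have "poly_shift [:- z, 1:] (poly_shift q f) (t - 1) = 0"
        using f(2) unfolding p poly_shift_mult by simp
      then show "poly_shift q f t = 0"
        unfolding poly_shift_linear by (simp add: True)
    qed
    then show ?thesis
      using Z by (intro exI[of _ Z] exI[of _ D]) simp
  next
    case False
    let ?W = "exp_poly_space (insert z Z) (Suc D)"
    have "f \<in> ?W" if f: "analytic_fun f" "poly_shift p f = (\<lambda>t. 0)" for f
    proof -
      have "p = q * [:- z, 1:]"
        unfolding p by (rule mult.commute)
      then have "poly_shift q (poly_shift [:- z, 1:] f) = (\<lambda>t. 0)"
        using f(2) by (simp only: poly_shift_mult)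
      then have "poly_shift [:- z, 1:] f \<in> exp_poly_space Z D"
        by (intro IH analytic_fun_poly_shift f(1))
      then have "poly_shift [:- z, 1:] f \<in> exp_poly_space (insert z Z) D"
        using exp_poly_space_mono[of "insert z Z" Z D D] Z(1) by auto
      then obtain h where h: "h \<in> ?W" "\<And>t. h (t + 1) - z * h t = f (t + 1) - z * f t"
        using difference_equation_solvable[of "insert z Z" z] Z False poly_shift_linear by fastforce
      define v where "v = (\<lambda>t. exp (- (Ln z * of_real t)) * (f t + (- 1) * h t))"
      have "f (t + 1) - h (t + 1) = z * (f t - h t)" for t
        using h(2)[of t] by (simp add: algebra_simps)
      moreover have "exp (- (Ln z * of_real (t + 1))) = exp (- (Ln z * of_real t)) * inverse z" for t
        unfolding exp_minus using False by (simp add: distrib_left exp_add)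
      ultimately have "v (t + 1) = v t" for t
        using False by (simp add: v_def)
      moreover have "analytic_fun (\<lambda>t. exp (- (Ln z * of_real t)))"
        by (rule analytic_fun_entire; intro holomorphic_intros)
      then have "analytic_fun v"
        unfolding v_def
        by (intro analytic_fun_mult analytic_fun_add analytic_fun_const f exp_poly_space_analytic[OF h(1)])
      ultimately have "v \<in> periodic_analytic"
        by (simp add: periodic_analytic_def)
      then have "(\<lambda>t. exp (Ln z * of_real t) * (v t * of_real t ^ 0)) \<in> ?W"
        by (intro exp_poly_monomial_in_space) (use Z in auto)
      then have "h + (\<lambda>t. exp (Ln z * of_real t) * (v t * of_real t ^ 0)) \<in> ?W"
        by (rule cfun.subspace_add[OF subspace_exp_poly_space h(1)])
      also have "h + (\<lambda>t. exp (Ln z * of_real t) * (v t * of_real t ^ 0)) = f"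
        by (simp add: v_def fun_eq_iff exp_minus flip: mult.assoc)
      finally show ?thesis .
    qed
    then show ?thesis
      using Z False by (intro exI[of _ "insert z Z"] exI[of _ "Suc D"]) simp
  qed
qed


text \<open>More iterated translates of one function than the dimension are linearly dependent, which gives
  a polynomial for that function. The product of the polynomials for the finitely many members of a
  basis serves for all functions, since the operators \<open>p(T)\<close> are linear and commute.\<close>
lemma shift_invariant_finite_dim_annihilated:
  assumes shift: "\<And>f. f \<in> G \<Longrightarrow> (\<lambda>t. f (t + 1)) \<in> G"
    and C: "finite C" "G \<subseteq> cfun.span C"
  shows "\<exists>p. p \<noteq> 0 \<and> (\<forall>f\<in>G. poly_shift p f = 0)"
proof -
  have iter: "(\<lambda>t. f (t + of_nat i)) \<in> G" if "f \<in> G" for f i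
  proof (induction i)
    case (Suc i)
    then show ?case using shift[OF Suc] by (simp add: add_ac)
  qed (use that in simp)
  have single: "\<exists>p. p \<noteq> 0 \<and> poly_shift p f = 0" if f: "f \<in> G" for f
  proof -
    define T where "T = (\<lambda>i::nat. \<lambda>t::real. f (t + of_nat i))"
    show ?thesis
    proof (cases "inj_on T {..card C}")
      case False
      then obtain i j where ij: "i \<noteq> j" "T i = T j" by (auto simp: inj_on_def)
      define p where "p = monom 1 i - monom (1::complex) j"
      have "coeff p i = 1" using ij(1) by (simp add: p_def)
      then have "p \<noteq> 0" by auto
      have "poly_shift p f t = 0" for t
      proof -
        have "degree p \<le> max i j"
          unfolding p_def by (intro degree_diff_le) (simp_all add: degree_monom_eq)
        then have "poly_shift p f t = (\<Sum>l\<le>max i j. coeff p l * T l t)"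
          unfolding T_def by (rule poly_shift_upto)
        also have "\<dots> = (\<Sum>l\<le>max i j. (if i = l then T l t else 0) - (if j = l then T l t else 0))"
          by (intro sum.cong) (auto simp: p_def)
        also have "\<dots> = T i t - T j t"
          by (simp add: sum_subtractf)
        finally show ?thesis using ij(2) by simp
      qed
      then show ?thesis using \<open>p \<noteq> 0\<close> by (intro exI[of _ p]) (auto simp: fun_eq_iff)
    next
      case True
      have "\<not> (card (T ` {..card C}) \<le> card C)"
        using True by (simp add: card_image)
      moreover have "T ` {..card C} \<subseteq> cfun.span C"
        using iter[OF f] C(2) by (auto simp: T_def)
      ultimately have "cfun.dependent (T ` {..card C})"
        using cfun.independent_span_bound[OF C(1)] by blast
      then obtain u i where u: "(\<Sum>v\<in>T ` {..card C}. cscale (u v) v) = 0" "i \<le> card C" "u (T i) \<noteq> 0"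
        by (subst (asm) cfun.dependent_finite) auto
      define p where "p = (\<Sum>l\<le>card C. monom (u (T l)) l)"
      have coeff: "coeff p l = (if l \<le> card C then u (T l) else 0)" for l
        by (simp add: p_def coeff_sum)
      then have "p \<noteq> 0" using u(2,3) by (metis coeff_0)
      have "poly_shift p f t = 0" for t
      proof -
        have "poly_shift p f t = (\<Sum>l\<le>card C. coeff p l * T l t)"
          unfolding T_def by (rule poly_shift_upto) (auto intro: degree_le simp: coeff)
        also have "\<dots> = (\<Sum>l\<le>card C. cscale (u (T l)) (T l)) t"
          by (simp add: sum_fun_at coeff cscale_def)
        also have "(\<Sum>l\<le>card C. cscale (u (T l)) (T l)) = 0"
          using u(1) True by (simp add: sum.reindex)
        finally show ?thesis by simp
      qed
      then show ?thesis using \<open>p \<noteq> 0\<close> by (intro exI[of _ p]) (auto simp: fun_eq_iff)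
    qed
  qed
  obtain B where B: "B \<subseteq> G" "cfun.independent B" "G \<subseteq> cfun.span B"
    using cfun.maximal_independent_subset[of G] by blast
  then have "finite B"
    using cfun.independent_span_bound[OF C(1), of B] C(2) by blast
  obtain P where P: "\<And>f. f \<in> B \<Longrightarrow> P f \<noteq> 0" "\<And>f. f \<in> B \<Longrightarrow> poly_shift (P f) f = 0"
    using single B(1) by (metis subsetD)
  define p where "p = (\<Prod>f\<in>B. P f)"
  have "p \<noteq> 0"
    using P(1) \<open>finite B\<close> by (simp add: p_def)
  have "cfun.subspace {f. poly_shift p f = 0}"
  proof (rule cfun.subspaceI)
    show "0 \<in> {f. poly_shift p f = 0}"
      by (simp add: poly_shift_def fun_eq_iff)
    show "f + g \<in> {f. poly_shift p f = 0}"
      if "f \<in> {f. poly_shift p f = 0}" "g \<in> {f. poly_shift p f = 0}" for f g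
      using that by (simp add: poly_shift_def fun_eq_iff distrib_left sum.distrib)
    show "cscale c f \<in> {f. poly_shift p f = 0}" if "f \<in> {f. poly_shift p f = 0}" for c f
    proof -
      have "poly_shift p (cscale c f) t = c * poly_shift p f t" for t
        by (simp add: poly_shift_def cscale_def sum_distrib_left mult_ac)
      then show ?thesis using that by (simp add: fun_eq_iff)
    qed
  qed
  moreover have "poly_shift p f = 0" if f: "f \<in> B" for f
  proof -
    have "p = (\<Prod>g\<in>B - {f}. P g) * P f"
      unfolding p_def using f \<open>finite B\<close> by (simp add: prod.remove mult.commute)
    then show ?thesis
      using P(2)[OF f] by (simp add: poly_shift_mult) (simp add: poly_shift_def fun_eq_iff)
  qed
  ultimately have "cfun.span B \<subseteq> {f. poly_shift p f = 0}"
    by (intro cfun.span_minimal) auto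
  then show ?thesis
    using B(3) \<open>p \<noteq> 0\<close> by blast
qed

section \<open>Finite-dimensional spans\<close>

text \<open>Induction on the number of generators. A new generator \<open>v\<close> at distance \<open>0\<close> from the old span
  contributes nothing modulo the kernel of \<open>q\<close>. Otherwise the distance is some \<open>\<delta> > 0\<close>, which bounds the
  coefficients of \<open>v\<close> by the seminorm: along approximations of \<open>f\<close> they form a Cauchy sequence, and
  subtracting the limiting multiple of \<open>v\<close> leaves a function approximated by the old span.\<close>
lemma finite_span_closed_under_seminorm:
  fixes q :: "(real \<Rightarrow> complex) \<Rightarrow> real"
  assumes V: "cfun.subspace V"
    and nonneg: "\<And>f. 0 \<le> q f"
    and tri: "\<And>f g. f \<in> V \<Longrightarrow> g \<in> V \<Longrightarrow> q (f + g) \<le> q f + q g"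
    and scale: "\<And>f c. f \<in> V \<Longrightarrow> q (cscale c f) = norm c * q f"
    and "finite B" "B \<subseteq> V" "f \<in> V"
    and "\<And>\<epsilon>. \<epsilon> > 0 \<Longrightarrow> \<exists>g\<in>cfun.span B. q (f - g) < \<epsilon>"
  shows "\<exists>g\<in>cfun.span B. q (f - g) = 0"
  using assms(5-)
proof (induction B arbitrary: f rule: finite_induct)
  case empty
  then have "q f < \<epsilon>" if "\<epsilon> > 0" for \<epsilon>
    using that by simp
  then have "q f = 0"
    using nonneg[of f] by (metis less_eq_real_def less_irrefl)
  then show ?case by simp
next
  case (insert v B)
  have v: "v \<in> V" and B: "B \<subseteq> V" using insert.prems(1) by auto
  have span: "cfun.span (insert v B) \<subseteq> V" "cfun.span B \<subseteq> V"
    using insert.prems(1) V B by (simp_all add: cfun.span_minimal)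
  note VI = cfun.subspace_add[OF V] cfun.subspace_diff[OF V] cfun.subspace_scale[OF V]
  have sym: "q (f - g) = q (g - f)" if "f \<in> V" "g \<in> V" for f g
  proof -
    have "cscale (- 1) (g - f) = f - g" by (simp add: cscale_def fun_eq_iff)
    then show ?thesis using scale[of "g - f" "- 1"] that VI by simp
  qed
  have sub: "cfun.span B \<subseteq> cfun.span (insert v B)"
    by (rule cfun.span_mono) auto
  show ?case
  proof (cases "\<exists>u\<in>cfun.span B. q (v - u) = 0")
    case True
    then obtain u where u: "u \<in> cfun.span B" "q (v - u) = 0" by blast
    have "\<exists>g\<in>cfun.span B. q (f - g) < \<epsilon>" if \<epsilon>: "\<epsilon> > 0" for \<epsilon>
    proof -
      obtain g where g: "g \<in> cfun.span (insert v B)" "q (f - g) < \<epsilon>"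
        using insert.prems(3)[OF \<epsilon>] by blast
      then obtain k where k: "g - cscale k v \<in> cfun.span B"
        using cfun.span_breakdown_eq by blast
      define g' where "g' = (g - cscale k v) + cscale k u"
      have "g' \<in> cfun.span B"
        unfolding g'_def using k u by (intro cfun.span_add cfun.span_scale)
      have 0: "q (cscale k (v - u)) = 0"
        using u span v VI by (subst scale) auto
      have "q (f - g') = q ((f - g) + cscale k (v - u))"
        by (rule arg_cong[of _ _ q]) (simp add: g'_def cscale_def fun_eq_iff algebra_simps)
      also have "\<dots> \<le> q (f - g) + q (cscale k (v - u))"
        using g(1) u(1) span insert.prems(2) v by (intro tri VI) auto
      also have "\<dots> < \<epsilon>"
        unfolding 0 using g(2) by simp
      finally show ?thesis
        using \<open>g' \<in> cfun.span B\<close> by blast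
    qed
    then have "\<exists>g\<in>cfun.span B. q (f - g) = 0"
      using insert.IH B insert.prems(2) by blast
    then show ?thesis using sub by blast
  next
    case False
    then obtain \<delta> where \<delta>: "\<delta> > 0" "\<And>u. u \<in> cfun.span B \<Longrightarrow> \<delta> \<le> q (v - u)"
      using insert.IH[OF B v] by (meson not_less)
    have dist: "norm k * \<delta> \<le> q (cscale k v + w)" if w: "w \<in> cfun.span B" for k w
    proof (cases "k = 0")
      case False
      have "cscale k v + w = cscale k (v - cscale (- 1 / k) w)"
        using False by (simp add: cscale_def fun_eq_iff algebra_simps)
      moreover have "cscale (- 1 / k) w \<in> cfun.span B"
        using w by (rule cfun.span_scale)
      ultimately show ?thesis
        using scale[OF VI(2)[OF v]] span(2) \<delta>(2) by (metis mult_left_mono norm_ge_zero subsetD)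
    qed (use nonneg in simp)
    have "\<forall>n. \<exists>g k. g \<in> cfun.span (insert v B) \<and> q (f - g) < inverse (real (Suc n)) \<and>
        g - cscale k v \<in> cfun.span B"
    proof
      fix n
      have "inverse (real (Suc n)) > 0" by simp
      from insert.prems(3)[OF this]
      obtain g where "g \<in> cfun.span (insert v B)" "q (f - g) < inverse (real (Suc n))"
        by blast
      moreover from this obtain k where "g - cscale k v \<in> cfun.span B"
        using cfun.span_breakdown_eq by blast
      ultimately show "\<exists>g k. g \<in> cfun.span (insert v B) \<and> q (f - g) < inverse (real (Suc n)) \<and>
          g - cscale k v \<in> cfun.span B"
        by blast
    qed
    then obtain g k where g: "\<And>n. g n \<in> cfun.span (insert v B)"
      "\<And>n. q (f - g n) < inverse (real (Suc n))"
      "\<And>n. g n - cscale (k n) v \<in> cfun.span B"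
      by metis
    have gV: "g n \<in> V" for n using g(1) span by blast
    have diff: "norm (k m - k n) * \<delta> < inverse (real (Suc m)) + inverse (real (Suc n))" for m n
    proof -
      have "(g m - cscale (k m) v) - (g n - cscale (k n) v) \<in> cfun.span B"
        by (rule cfun.span_diff[OF g(3) g(3)])
      from dist[OF this, of "k m - k n"]
      have "norm (k m - k n) * \<delta> \<le> q (cscale (k m - k n) v +
          ((g m - cscale (k m) v) - (g n - cscale (k n) v)))" .
      also have "q (cscale (k m - k n) v + ((g m - cscale (k m) v) - (g n - cscale (k n) v))) =
          q ((g m - f) + (f - g n))"
        by (rule arg_cong[of _ _ q]) (simp add: cscale_def fun_eq_iff algebra_simps)
      also have "\<dots> \<le> q (g m - f) + q (f - g n)"
        using gV insert.prems(2) by (intro tri VI)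
      also have "\<dots> < inverse (real (Suc m)) + inverse (real (Suc n))"
        using sym[OF gV insert.prems(2), of m] g(2)[of m] g(2)[of n] by simp
      finally show ?thesis .
    qed
    have "Cauchy k"
    proof (rule metric_CauchyI)
      fix e :: real assume "e > 0"
      then obtain M where M: "inverse (real (Suc M)) < e * \<delta> / 2"
        using reals_Archimedean[of "e * \<delta> / 2"] \<delta>(1) by auto
      have "dist (k m) (k n) < e" if "m \<ge> M" "n \<ge> M" for m n
      proof -
        have "inverse (real (Suc m)) \<le> inverse (real (Suc M))"
             "inverse (real (Suc n)) \<le> inverse (real (Suc M))"
          using that by (simp_all add: le_imp_inverse_le del: of_nat_Suc)
        then have "norm (k m - k n) * \<delta> < e * \<delta>"
          using diff[of m n] M by linarith
        then show ?thesis
          using \<delta>(1) by (simp add: dist_norm)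
      qed
      then show "\<exists>M. \<forall>m\<ge>M. \<forall>n\<ge>M. dist (k m) (k n) < e" by blast
    qed
    then obtain c where c: "k \<longlonglongrightarrow> c"
      using Cauchy_convergent convergent_def by blast
    have "(\<lambda>n. inverse (real (Suc n)) + norm (k n - c) * q v) \<longlonglongrightarrow> 0 + norm (c - c) * q v"
      by (intro tendsto_intros LIMSEQ_inverse_real_of_nat c)
    then have lim: "(\<lambda>n. inverse (real (Suc n)) + norm (k n - c) * q v) \<longlonglongrightarrow> 0" by simp
    have "\<exists>u\<in>cfun.span B. q ((f - cscale c v) - u) < \<epsilon>" if \<epsilon>: "\<epsilon> > 0" for \<epsilon>
    proof -
      obtain n where n: "inverse (real (Suc n)) + norm (k n - c) * q v < \<epsilon>"
        using order_tendstoD(2)[OF lim \<epsilon>] by (auto simp: eventually_sequentially)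
      have "q ((f - cscale c v) - (g n - cscale (k n) v)) = q ((f - g n) + cscale (k n - c) v)"
        by (rule arg_cong[of _ _ q]) (simp add: cscale_def fun_eq_iff algebra_simps)
      also have "\<dots> \<le> q (f - g n) + q (cscale (k n - c) v)"
        using gV insert.prems(2) v by (intro tri VI)
      also have "\<dots> < \<epsilon>"
        using g(2)[of n] n scale[OF v, of "k n - c"] by simp
      finally show ?thesis using g(3) by blast
    qed
    then obtain u where u: "u \<in> cfun.span B" "q ((f - cscale c v) - u) = 0"
      using insert.IH[of "f - cscale c v"] B insert.prems(2) v VI by blast
    have "u + cscale c v \<in> cfun.span (insert v B)"
      by (intro cfun.span_add cfun.span_scale subsetD[OF sub u(1)]) (simp add: cfun.span_base)
    moreover have "f - (u + cscale c v) = (f - cscale c v) - u"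
      by (simp add: fun_eq_iff)
    ultimately show ?thesis using u(2) by metis
  qed
qed

text \<open>The reduction of \<open>G\<close> modulo \<open>N\<close> is injective and lies in the span of \<open>B\<close>. The generators are removed
  one at a time: those elements of \<open>G\<close> that can do without the generator \<open>v\<close> form a subspace, and it has
  codimension at most one, because any element \<open>h\<close> outside it can be used to cancel \<open>v\<close> in the others.\<close>
lemma subspace_spanned_by_card:
  assumes "finite B" and "cfun.subspace G" and N: "cfun.subspace N" and "G \<inter> N \<subseteq> {0}"
    and "\<And>f. f \<in> G \<Longrightarrow> \<exists>g\<in>cfun.span B. f - g \<in> N"
  shows "\<exists>C. finite C \<and> card C \<le> card B \<and> G \<subseteq> cfun.span C"
  using assms(1,2,4,5)
proof (induction B arbitrary: G rule: finite_induct)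
  case empty
  have "f = 0" if "f \<in> G" for f
    using empty.prems(2,3) that by fastforce
  then have "G \<subseteq> cfun.span {}"
    by auto
  then show ?case by (intro exI[of _ "{}"]) auto
next
  case (insert v B)
  define G' where "G' = {f \<in> G. \<exists>g\<in>cfun.span B. f - g \<in> N}"
  note sG = cfun.subspace_add[OF insert.prems(1)] cfun.subspace_scale[OF insert.prems(1)]
    cfun.subspace_0[OF insert.prems(1)] cfun.subspace_diff[OF insert.prems(1)]
  note sN = cfun.subspace_add[OF N] cfun.subspace_scale[OF N] cfun.subspace_0[OF N] cfun.subspace_diff[OF N]
  have "cfun.subspace G'"
  proof (rule cfun.subspaceI)
    have "0 - 0 \<in> N" using sN(3) by simp
    then show "0 \<in> G'"
      unfolding G'_def using sG(3) cfun.span_zero by blast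
  next
    fix f h assume "f \<in> G'" "h \<in> G'"
    then obtain f' h' where *: "f' \<in> cfun.span B" "f - f' \<in> N" "h' \<in> cfun.span B" "h - h' \<in> N"
      "f \<in> G" "h \<in> G"
      unfolding G'_def by blast
    have "(f + h) - (f' + h') = (f - f') + (h - h')" by simp
    then show "f + h \<in> G'"
      unfolding G'_def mem_Collect_eq
      using sN(1)[OF *(2,4)] sG(1)[OF *(5,6)] cfun.span_add[OF *(1,3)] by metis
  next
    fix c f assume "f \<in> G'"
    then obtain f' where *: "f' \<in> cfun.span B" "f - f' \<in> N" "f \<in> G"
      unfolding G'_def by blast
    have "cscale c f - cscale c f' = cscale c (f - f')"
      by (simp add: cscale_def fun_eq_iff algebra_simps)
    then show "cscale c f \<in> G'"
      unfolding G'_def mem_Collect_eq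
      using sN(2)[OF *(2)] sG(2)[OF *(3)] cfun.span_scale[OF *(1)] by metis
  qed
  moreover have "G' \<inter> N \<subseteq> {0}" using insert.prems(2) unfolding G'_def by blast
  moreover have "\<exists>g\<in>cfun.span B. f - g \<in> N" if "f \<in> G'" for f
    using that unfolding G'_def by blast
  ultimately have "\<exists>C. finite C \<and> card C \<le> card B \<and> G' \<subseteq> cfun.span C"
    by (rule insert.IH)
  then obtain C where C: "finite C" "card C \<le> card B" "G' \<subseteq> cfun.span C"
    by blast
  show ?case
  proof (cases "G \<subseteq> G'")
    case True
    then show ?thesis using C insert.hyps by (intro exI[of _ C]) auto
  next
    case False
    then obtain h where h: "h \<in> G" "h \<notin> G'" by blast
    then obtain h' where h': "h' \<in> cfun.span (insert v B)" "h - h' \<in> N"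
      using insert.prems(3) by blast
    then obtain k where k: "h' - cscale k v \<in> cfun.span B"
      using cfun.span_breakdown_eq by blast
    have "k \<noteq> 0"
    proof
      assume "k = 0"
      then have "h' \<in> cfun.span B" using k by (simp add: cfun.scale_zero_left)
      then show False using h h'(2) unfolding G'_def by blast
    qed
    have "f \<in> cfun.span (insert h C)" if f: "f \<in> G" for f
    proof -
      obtain f' where f': "f' \<in> cfun.span (insert v B)" "f - f' \<in> N"
        using insert.prems(3)[OF f] by blast
      then obtain l where l: "f' - cscale l v \<in> cfun.span B"
        using cfun.span_breakdown_eq by blast
      define c where "c = l / k"
      have "f' - cscale c h' = (f' - cscale l v) - cscale c (h' - cscale k v)"
        using \<open>k \<noteq> 0\<close> by (simp add: c_def cscale_def fun_eq_iff field_simps)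
      also have "\<dots> \<in> cfun.span B"
        by (rule cfun.span_diff[OF l cfun.span_scale[OF k]])
      finally have *: "f' - cscale c h' \<in> cfun.span B" .
      have "(f - cscale c h) - (f' - cscale c h') = (f - f') - cscale c (h - h')"
        by (simp add: cscale_def fun_eq_iff algebra_simps)
      also have "\<dots> \<in> N" by (rule sN(4)[OF f'(2) sN(2)[OF h'(2)]])
      finally have "f - cscale c h \<in> G'"
        unfolding G'_def using * sG(4)[OF f sG(2)[OF h(1)]] by blast
      then have "f - cscale c h \<in> cfun.span C"
        using C(3) by blast
      then show ?thesis
        unfolding cfun.span_breakdown_eq by blast
    qed
    moreover have "card (insert h C) \<le> card (insert v B)"
      using C(1,2) insert.hyps by (simp add: card_insert_if)
    ultimately show ?thesis using C(1) by (intro exI[of _ "insert h C"]) auto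
  qed
qed

section \<open>Integer translates of finitely many compact sets\<close>

lemma lebesgue_integrable_translate:
  fixes f :: "real \<Rightarrow> 'a::euclidean_space"
  shows "integrable lebesgue (\<lambda>t. f (t + c)) \<longleftrightarrow> integrable lebesgue f"
  using lebesgue_integrable_real_affine_iff[of 1 f c] by (simp add: add.commute)

lemma lebesgue_integral_translate:
  fixes f :: "real \<Rightarrow> 'a::euclidean_space"
  shows "(LINT t|lebesgue. f (t + c)) = (LINT t|lebesgue. f t)"
  using lebesgue_integral_real_affine[of 1 f c] by (simp add: add.commute)

lemma AE_lebesgue_translate:
  fixes P :: "real \<Rightarrow> bool"
  assumes "AE t in lebesgue. P t"
  shows "AE t in lebesgue. P (t + c)"
proof -
  obtain N where N: "negligible N" "{t. \<not> P t} \<subseteq> N"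
    using assms unfolding eventually_ae_filter_negligible by blast
  have "{t. \<not> P (t + c)} \<subseteq> (+) (- c) ` N"
  proof
    fix t assume "t \<in> {t. \<not> P (t + c)}"
    then have "t + c \<in> N" using N(2) by auto
    then show "t \<in> (+) (- c) ` N" by (intro image_eqI[of _ _ "t + c"]) auto
  qed
  then show ?thesis
    unfolding eventually_ae_filter_negligible using negligible_translation[OF N(1)] by blast
qed

lemma compact_sets_common_bound:
  fixes S :: "'i \<Rightarrow> real set"
  assumes "finite J" "\<forall>j\<in>J. compact (S j)"
  obtains r :: int where "\<And>j x. j \<in> J \<Longrightarrow> x \<in> S j \<Longrightarrow> \<bar>x\<bar> \<le> of_int r"
proof -
  have "bounded (\<Union>j\<in>J. S j)"
    using assms by (intro bounded_UN) (auto intro: compact_imp_bounded)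
  then obtain b where b: "\<And>x. x \<in> (\<Union>j\<in>J. S j) \<Longrightarrow> \<bar>x\<bar> \<le> b"
    unfolding bounded_iff by auto
  have "\<bar>x\<bar> \<le> of_int \<lceil>b\<rceil>" if "j \<in> J" "x \<in> S j" for j x
    using b[of x] that le_of_int_ceiling[of b] by (meson UN_I order_trans)
  then show ?thesis by (rule that)
qed

text \<open>The number of pairs \<open>(j, k)\<close> with \<open>a - k \<in> S j\<close>, integrated over \<open>a\<close> in the unit interval, is the total
  measure of the sets. Hence it cannot exceed that total everywhere.\<close>
lemma exists_point_in_few_translates:
  fixes S :: "'i \<Rightarrow> real set"
  assumes J: "finite J" and S: "\<forall>j\<in>J. compact (S j)"
  obtains a :: real where "finite {(j, k :: int). j \<in> J \<and> a - of_int k \<in> S j}"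
    "real (card {(j, k :: int). j \<in> J \<and> a - of_int k \<in> S j}) \<le> (\<Sum>j\<in>J. measure lebesgue (S j))"
proof -
  obtain r :: int where r: "\<And>j x. j \<in> J \<Longrightarrow> x \<in> S j \<Longrightarrow> \<bar>x\<bar> \<le> of_int r"
    using compact_sets_common_bound[OF J S] by blast
  define I where "I = {- r - 1..r + 1}"
  define P where "P = (\<lambda>a :: real. {(j, k :: int). j \<in> J \<and> a - of_int k \<in> S j})"
  define N where "N = (\<lambda>a :: real. \<Sum>j\<in>J. \<Sum>k\<in>I. indicat_real (S j) (a - of_int k))"
  define L where "L = (\<Sum>j\<in>J. measure lebesgue (S j))"
  have fin: "finite (P a)" and card: "N a = real (card (P a))" if a: "a \<in> {0..<1}" for a
  proof -
    have "k \<in> I" if "j \<in> J" "a - of_int k \<in> S j" for j k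
    proof -
      have "\<bar>a - of_int k\<bar> \<le> of_int r" using r that by blast
      then have "real_of_int k < of_int (r + 2)" "of_int (- r - 1) \<le> real_of_int k"
        using a by auto
      then show ?thesis
        unfolding I_def of_int_le_iff of_int_less_iff by auto
    qed
    then have P: "P a = Sigma J (\<lambda>j. I \<inter> {k. a - of_int k \<in> S j})"
      unfolding P_def by auto
    then show "finite (P a)"
      using J by (auto simp: I_def)
    show "N a = real (card (P a))"
      unfolding P N_def using J by (simp add: I_def indicator_def)
  qed
  have meas: "S j \<in> lmeasurable" if "j \<in> J" for j
    using S that by (blast intro: lmeasurable_compact)
  define u where "u = (\<lambda>j k a. indicat_real {0..<1} a * indicat_real (S j) (a - of_int k))"
  have u_shift: "u j k (b + of_int k) = indicat_real ({- of_int k..<1 - of_int k} \<inter> S j) b" for j k b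
    by (auto simp: u_def indicator_def)
  have u_int: "integrable lebesgue (u j k)"
    and u_integral: "(LINT a|lebesgue. u j k a) =
      (LINT b|lebesgue. indicat_real ({- of_int k..<1 - of_int k} \<inter> S j) b)" if "j \<in> J" for j k
  proof -
    have "{- real_of_int k..<1 - of_int k} \<inter> S j \<in> lmeasurable"
      using meas[OF that] by (subst Int_commute) (intro fmeasurable_Int_fmeasurable, auto)
    then have "integrable lebesgue (indicat_real ({- of_int k..<1 - of_int k} \<inter> S j))"
      by (simp only: lmeasurable_iff_integrable)
    then have "integrable lebesgue (\<lambda>b. u j k (b + of_int k))"
      unfolding u_shift .
    then show "integrable lebesgue (u j k)"
      by (simp only: lebesgue_integrable_translate)
    show "(LINT a|lebesgue. u j k a) =
        (LINT b|lebesgue. indicat_real ({- of_int k..<1 - of_int k} \<inter> S j) b)"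
      using lebesgue_integral_translate[of "u j k" "of_int k"] by (simp add: u_shift)
  qed
  \<comment> \<open>The unit interval is a fundamental domain, so the translates of \<open>S j\<close> cover it
    with total multiplicity the measure of \<open>S j\<close>.\<close>
  have unfold: "(\<Sum>k\<in>I. LINT a|lebesgue. u j k a) = measure lebesgue (S j)" if j: "j \<in> J" for j
  proof -
    have pt: "(\<Sum>k\<in>I. indicat_real ({- of_int k..<1 - of_int k} \<inter> S j) b) = indicat_real (S j) b" for b
    proof (cases "b \<in> S j")
      case True
      have "\<bar>b\<bar> \<le> of_int r" using r j True by blast
      then have "of_int (- r) \<le> b" "b < of_int (r + 1)" by auto
      then have "- r \<le> \<lfloor>b\<rfloor>" "\<lfloor>b\<rfloor> < r + 1" by (simp_all only: le_floor_iff floor_less_iff)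
      then have "- \<lfloor>b\<rfloor> \<in> I" unfolding I_def by auto
      have "indicat_real ({- of_int k..<1 - of_int k} \<inter> S j) b = (if - \<lfloor>b\<rfloor> = k then 1 else 0)" for k
      proof -
        have "b \<in> {- of_int k..<1 - of_int k} \<longleftrightarrow> \<lfloor>b\<rfloor> = - k"
          by (auto simp: floor_eq_iff)
        then show ?thesis using True by (auto simp: indicator_def)
      qed
      then show ?thesis using \<open>- \<lfloor>b\<rfloor> \<in> I\<close> True by (simp add: I_def)
    qed auto
    have "(\<Sum>k\<in>I. LINT a|lebesgue. u j k a) =
        (\<Sum>k\<in>I. LINT b|lebesgue. indicat_real ({- of_int k..<1 - of_int k} \<inter> S j) b)"
      using u_integral[OF j] by simp
    also have "\<dots> = (LINT b|lebesgue. (\<Sum>k\<in>I. indicat_real ({- of_int k..<1 - of_int k} \<inter> S j) b))"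
    proof (rule Bochner_Integration.integral_sum[symmetric])
      fix k
      show "integrable lebesgue (indicat_real ({- of_int k..<1 - of_int k} \<inter> S j))"
        using u_int[OF j, of k] unfolding lebesgue_integrable_translate[of "u j k" "of_int k", symmetric] u_shift .
    qed
    also have "\<dots> = measure lebesgue (S j)"
      unfolding pt using meas[OF j] by (simp add: fmeasurable_def)
    finally show ?thesis .
  qed
  have N_u: "indicat_real {0..<1} a * N a = (\<Sum>j\<in>J. \<Sum>k\<in>I. u j k a)" for a
    by (simp add: N_def u_def sum_distrib_left)
  have int_N: "integrable lebesgue (\<lambda>a. indicat_real {0..<1} a * N a)"
    unfolding N_u using u_int by (intro Bochner_Integration.integrable_sum) auto
  have "(LINT a|lebesgue. indicat_real {0..<1} a * N a) = (\<Sum>j\<in>J. \<Sum>k\<in>I. LINT a|lebesgue. u j k a)"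
    unfolding N_u using u_int by (simp add: Bochner_Integration.integral_sum)
  also have "\<dots> = L"
    unfolding L_def using unfold by simp
  finally have N_integral: "(LINT a|lebesgue. indicat_real {0..<1} a * N a) = L" .
  have "\<exists>a\<in>{0..<1}. real (card (P a)) \<le> L"
  proof (rule ccontr)
    assume contra: "\<not> ?thesis"
    \<comment> \<open>The multiplicity is an integer, which turns the pointwise strict inequality into a
      uniform gap.\<close>
    have "of_int (\<lfloor>L\<rfloor> + 1) \<le> N a" if "a \<in> {0..<1}" for a
    proof -
      have "L < real_of_int (int (card (P a)))" using contra that by force
      then have "\<lfloor>L\<rfloor> < int (card (P a))" by (simp only: floor_less_iff)
      then have "real_of_int (\<lfloor>L\<rfloor> + 1) \<le> real_of_int (int (card (P a)))" by (simp only: of_int_le_iff)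
      then show ?thesis using card[OF that] by simp
    qed
    then have le: "indicat_real {0..<1} a * of_int (\<lfloor>L\<rfloor> + 1) \<le> indicat_real {0..<1} a * N a" for a :: real
      by (auto simp: indicator_def)
    have "integrable lebesgue (indicat_real {0..<1::real})"
      by simp
    then have "(LINT a|lebesgue. indicat_real {0..<1::real} a * of_int (\<lfloor>L\<rfloor> + 1)) \<le>
        (LINT a|lebesgue. indicat_real {0..<1} a * N a)"
      using int_N le by (intro integral_mono) auto
    then have "of_int (\<lfloor>L\<rfloor> + 1) \<le> L" unfolding N_integral by simp
    then show False by linarith
  qed
  then obtain a where "a \<in> {0..<1}" "real (card (P a)) \<le> L" by blast
  then show ?thesis
    using fin[of a] unfolding P_def L_def by (intro that) auto
qed

text \<open>Translates by large \<open>k\<close> stay away from \<open>a\<close> because the sets are bounded; the remaining ones are finitely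
  many closed sets, so those that avoid \<open>a\<close> avoid a whole neighbourhood.\<close>
lemma avoided_translates_locally_avoided:
  fixes S :: "'i \<Rightarrow> real set"
  assumes J: "finite J" and S: "\<forall>j\<in>J. compact (S j)"
  obtains \<delta> where "\<delta> > 0"
    "\<And>j k t. j \<in> J \<Longrightarrow> a - of_int k \<notin> S j \<Longrightarrow> t \<in> cball a \<delta> \<Longrightarrow> t - of_int k \<notin> S j"
proof -
  obtain r :: int where r: "\<And>j x. j \<in> J \<Longrightarrow> x \<in> S j \<Longrightarrow> \<bar>x\<bar> \<le> of_int r"
    using compact_sets_common_bound[OF J S] by blast
  define R where "R = r + \<lceil>\<bar>a\<bar>\<rceil> + 1"
  define Q where "Q = {(j, k). j \<in> J \<and> k \<in> {- R..R} \<and> a - of_int k \<notin> S j}"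
  have "Q \<subseteq> J \<times> {- R..R}" by (auto simp: Q_def)
  then have "finite Q" using J finite_subset by blast
  define U where "U = (\<Union>(j, k)\<in>Q. (\<lambda>x. x + of_int k) ` S j)"
  have "closed U"
    unfolding U_def using \<open>finite Q\<close> S
    by (intro closed_UN) (auto simp: Q_def intro!: compact_imp_closed compact_continuous_image continuous_on_add)
  moreover have "a \<notin> U"
    by (auto simp: U_def Q_def)
  ultimately obtain e where e: "e > 0" "cball a e \<subseteq> - U"
    using open_contains_cball[of "- U"] by blast
  show ?thesis
  proof (rule that[of "min e 1"])
    show "min e 1 > 0" using e(1) by simp
    fix j k t assume j: "j \<in> J" "a - of_int k \<notin> S j" and t: "t \<in> cball a (min e 1)"
    show "t - of_int k \<notin> S j"
    proof
      assume "t - of_int k \<in> S j"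
      then have "\<bar>t - of_int k\<bar> \<le> of_int r" using r j(1) by blast
      moreover have "\<bar>a - t\<bar> \<le> 1" using t by (simp add: dist_real_def)
      moreover have "\<bar>a\<bar> \<le> of_int \<lceil>\<bar>a\<bar>\<rceil>" by (rule le_of_int_ceiling)
      ultimately have "\<bar>real_of_int k\<bar> \<le> of_int R"
        unfolding R_def of_int_add of_int_1 by linarith
      then have "(j, k) \<in> Q" using j by (auto simp: Q_def)
      then have "t \<in> U"
        unfolding U_def using \<open>t - of_int k \<in> S j\<close> by force
      then show False using e(2) t by auto
    qed
  qed
qed

section \<open>Analytic functions in the shift-invariant space\<close>

text \<open>The complement of the essential support is a union of possibly uncountably many open sets on
  which \<open>f\<close> vanishes almost everywhere; by Lindelof countably many of them suffice.\<close>
lemma AE_zero_off_ess_support: "AE t in lebesgue. t \<notin> ess_support f \<longrightarrow> f t = 0"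
proof -
  define \<U> where "\<U> = {U. open U \<and> (AE t in lebesgue. t \<in> U \<longrightarrow> f t = 0)}"
  obtain \<V> where \<V>: "\<V> \<subseteq> \<U>" "countable \<V>" "\<Union>\<V> = \<Union>\<U>"
    using Lindelof[of \<U>] unfolding \<U>_def by blast
  have "AE t in lebesgue. \<forall>U\<in>\<V>. t \<in> U \<longrightarrow> f t = 0"
    using \<V>(1,2) by (subst AE_ball_countable) (auto simp: \<U>_def)
  moreover have "- ess_support f = \<Union>\<V>"
    unfolding ess_support_def \<V>(3) \<U>_def by simp
  ultimately show ?thesis
    by (elim eventually_mono) blast
qed

text \<open>On the window \<open>K\<close> only the pairs in \<open>P\<close> contribute, whatever the coefficients are: a translate
  whose support avoids \<open>K\<close> vanishes almost everywhere there. Moving the window by the integer \<open>m\<close>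
  merely renumbers the coefficients.\<close>
lemma shift_sum_on_window:
  fixes c :: "nat \<Rightarrow> int \<Rightarrow> complex" and m :: int
  assumes P: "P = {(j, k :: int). j \<in> {1..n} \<and> a - of_int k \<in> ess_support (\<phi> j)}" "finite P"
    and avoid: "\<And>j k t. j \<in> {1..n} \<Longrightarrow> a - of_int k \<notin> ess_support (\<phi> j) \<Longrightarrow> t \<in> K \<Longrightarrow>
      t - of_int k \<notin> ess_support (\<phi> j)"
  shows "AE t in lebesgue. t \<in> K \<longrightarrow>
    (\<Sum>j=1..n. \<Sum>\<^sub>\<infinity>k::int. c j k * \<phi> j (t + of_int m - of_int k)) =
    (\<Sum>(j, l)\<in>P. c j (l + m) * \<phi> j (t - of_int l))"
proof -
  have "AE t in lebesgue. t - of_int l \<notin> ess_support (\<phi> j) \<longrightarrow> \<phi> j (t - of_int l) = 0"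
    for j and l :: int
    using AE_lebesgue_translate[OF AE_zero_off_ess_support[of "\<phi> j"], of "- of_int l"] by simp
  then have "AE t in lebesgue. \<forall>j. \<forall>l::int. t - of_int l \<notin> ess_support (\<phi> j) \<longrightarrow> \<phi> j (t - of_int l) = 0"
    unfolding AE_all_countable by blast
  then show ?thesis
  proof (rule eventually_mono, intro impI)
    fix t assume t: "\<forall>j. \<forall>l::int. t - of_int l \<notin> ess_support (\<phi> j) \<longrightarrow> \<phi> j (t - of_int l) = 0"
      and K: "t \<in> K"
    define L where "L = (\<lambda>j. {l. (j, l) \<in> P})"
    have PL: "P = Sigma {1..n} L" unfolding L_def P(1) by auto
    have finL: "finite (L j)" for j
    proof -
      have "L j \<subseteq> snd ` P" by (force simp: L_def)
      then show ?thesis using P(2) finite_subset by blast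
    qed
    have "(\<Sum>\<^sub>\<infinity>k::int. c j k * \<phi> j (t + of_int m - of_int k)) =
        (\<Sum>l\<in>L j. c j (l + m) * \<phi> j (t - of_int l))" if j: "j \<in> {1..n}" for j
    proof -
      have "c j k * \<phi> j (t + of_int m - of_int k) = 0" if "k \<notin> (\<lambda>l. l + m) ` L j" for k
      proof -
        have "k - m \<notin> L j" using that by force
        then have "t - of_int (k - m) \<notin> ess_support (\<phi> j)"
          using avoid[OF j _ K, of "k - m"] j unfolding L_def P(1) by blast
        then have "\<phi> j (t - of_int (k - m)) = 0" using t by blast
        then show ?thesis by (simp add: algebra_simps)
      qed
      then have "(\<Sum>\<^sub>\<infinity>k::int. c j k * \<phi> j (t + of_int m - of_int k)) =
          (\<Sum>\<^sub>\<infinity>k\<in>(\<lambda>l. l + m) ` L j. c j k * \<phi> j (t + of_int m - of_int k))"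
        by (intro infsum_cong_neutral) auto
      also have "\<dots> = (\<Sum>k\<in>(\<lambda>l. l + m) ` L j. c j k * \<phi> j (t + of_int m - of_int k))"
        using finL by simp
      also have "\<dots> = (\<Sum>l\<in>L j. c j (l + m) * \<phi> j (t - of_int l))"
        by (subst sum.reindex) (auto simp: inj_on_def)
      finally show ?thesis .
    qed
    then show "(\<Sum>j=1..n. \<Sum>\<^sub>\<infinity>k::int. c j k * \<phi> j (t + of_int m - of_int k)) =
        (\<Sum>(j, l)\<in>P. c j (l + m) * \<phi> j (t - of_int l))"
      unfolding PL using finL by (subst sum.Sigma[symmetric]) auto
  qed
qed

lemma set_lebesgue_cball_translate:
  fixes f :: "real \<Rightarrow> 'a::euclidean_space"
  shows "set_integrable lebesgue (cball a \<delta>) (\<lambda>t. f (t + c)) \<longleftrightarrow> set_integrable lebesgue (cball (a + c) \<delta>) f"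
    and "(LINT t:cball a \<delta>|lebesgue. f (t + c)) = (LINT t:cball (a + c) \<delta>|lebesgue. f t)"
proof -
  have eq: "indicat_real (cball a \<delta>) t = indicat_real (cball (a + c) \<delta>) (t + c)" for t
    by (simp add: indicator_def dist_real_def)
  show "set_integrable lebesgue (cball a \<delta>) (\<lambda>t. f (t + c)) \<longleftrightarrow> set_integrable lebesgue (cball (a + c) \<delta>) f"
    unfolding set_integrable_def eq
    using lebesgue_integrable_translate[of "\<lambda>t. indicat_real (cball (a + c) \<delta>) t *\<^sub>R f t" c] by simp
  show "(LINT t:cball a \<delta>|lebesgue. f (t + c)) = (LINT t:cball (a + c) \<delta>|lebesgue. f t)"
    unfolding set_lebesgue_integral_def eq
    using lebesgue_integral_translate[of "\<lambda>t. indicat_real (cball (a + c) \<delta>) t *\<^sub>R f t" c] by simp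
qed

text \<open>The ball around \<open>f\<close> for one seminorm is itself one of the sets that generate the topology.\<close>
lemma closure_approx_in_L1:
  assumes "f \<in> L1_loc_topology closure_of S" "compact K" "\<epsilon> > 0"
  shows "f \<in> L1_loc" and "\<exists>g\<in>S \<inter> L1_loc. (LINT t:K|lebesgue. norm (g t - f t)) < \<epsilon>"
proof -
  have "topspace L1_loc_topology \<subseteq> L1_loc"
    unfolding L1_loc_topology_def topology_generated_by_topspace by (intro Union_least) auto
  then show f: "f \<in> L1_loc"
    using assms(1) closure_of_subset_topspace[of L1_loc_topology S] by (meson subsetD)
  define U where "U = {g \<in> L1_loc. (LINT t:K|lebesgue. norm (g t - f t)) < \<epsilon>}"
  have "openin L1_loc_topology U"
    unfolding L1_loc_topology_def openin_topology_generated_by_iff U_def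
    by (rule generate_topology_on.Basis) (use f assms(2,3) in auto)
  moreover have "f \<in> U"
    using f assms(3) by (simp add: U_def set_lebesgue_integral_def)
  ultimately obtain g where "g \<in> S" "g \<in> U"
    using assms(1) unfolding in_closure_of by blast
  then show "\<exists>g\<in>S \<inter> L1_loc. (LINT t:K|lebesgue. norm (g t - f t)) < \<epsilon>"
    unfolding U_def by blast
qed

text \<open>Before taking the closure this is \<open>shift_sum_on_window\<close>. It persists in the
  closure because \<open>L1\<close>-convergence on the window cannot leave a finite-dimensional span.\<close>
lemma shift_invariant_space_on_window:
  fixes \<phi> :: "nat \<Rightarrow> real \<Rightarrow> complex"
  assumes f: "f \<in> shift_invariant_space n \<phi>"
    and int: "\<And>j. j \<in> {1..n} \<Longrightarrow> integrable lebesgue (\<phi> j)"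
    and P: "P = {(j, k :: int). j \<in> {1..n} \<and> a - of_int k \<in> ess_support (\<phi> j)}" "finite P"
    and avoid: "\<And>j k t. j \<in> {1..n} \<Longrightarrow> a - of_int k \<notin> ess_support (\<phi> j) \<Longrightarrow> t \<in> cball a \<delta> \<Longrightarrow>
      t - of_int k \<notin> ess_support (\<phi> j)"
  shows "\<exists>h\<in>cfun.span ((\<lambda>(j, k) t. \<phi> j (t - of_int k)) ` P).
    AE t in lebesgue. t \<in> cball a \<delta> \<longrightarrow> f (t + of_int m) = h t"
proof -
  define K where "K = cball a \<delta>"
  define e where "e = (\<lambda>(j, k) t. \<phi> j (t - of_int k))"
  define V :: "(real \<Rightarrow> complex) set" where "V = {f. set_integrable lebesgue K f}"
  define q where "q = (\<lambda>f :: real \<Rightarrow> complex. LINT t:K|lebesgue. norm (f t))"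
  have Km: "K \<in> sets lebesgue" by (simp add: K_def)
  have V: "cfun.subspace V"
  proof (rule cfun.subspaceI)
    show "0 \<in> V" by (simp add: V_def set_integrable_def)
    show "f + g \<in> V" if "f \<in> V" "g \<in> V" for f g
      using that set_integral_add(1)[of lebesgue K f g] by (simp add: V_def plus_fun_def)
    show "cscale c f \<in> V" if "f \<in> V" for c f
      using that by (simp add: V_def cscale_def)
  qed
  have norm_V: "set_integrable lebesgue K (\<lambda>t. norm (f t))" if "f \<in> V" for f
    using that unfolding V_def by (simp add: set_integrable_norm)
  have q_nonneg: "0 \<le> q f" for f
    unfolding q_def set_lebesgue_integral_def by (intro integral_nonneg_AE) auto
  have q_tri: "q (f + g) \<le> q f + q g" if "f \<in> V" "g \<in> V" for f g
  proof -
    have "q (f + g) \<le> (LINT t:K|lebesgue. norm (f t) + norm (g t))"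
      unfolding q_def using norm_V[OF that(1)] norm_V[OF that(2)] norm_V[OF cfun.subspace_add[OF V that]]
      by (intro set_integral_mono set_integral_add) (auto intro: norm_triangle_ineq)
    also have "\<dots> = q f + q g"
      unfolding q_def using norm_V that by (intro set_integral_add) auto
    finally show ?thesis .
  qed
  have q_scale: "q (cscale c f) = norm c * q f" for c f
    by (simp add: q_def cscale_def norm_mult)
  have eV: "e ` P \<subseteq> V"
  proof
    fix f assume "f \<in> e ` P"
    then obtain j k where j: "j \<in> {1..n}" and f: "f = (\<lambda>t. \<phi> j (t - of_int k))"
      unfolding P(1) e_def by auto
    have "integrable lebesgue f"
      unfolding f using int[OF j] lebesgue_integrable_translate[of "\<phi> j" "- of_int k"] by simp
    then have "set_integrable lebesgue UNIV f" by (simp add: set_integrable_def)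
    then show "f \<in> V"
      unfolding V_def mem_Collect_eq using Km by (rule set_integrable_subset) auto
  qed
  have translate_V: "(\<lambda>t. g (t + of_int m)) \<in> V" if "g \<in> L1_loc" for g
    using that unfolding V_def K_def L1_loc_def by (simp add: set_lebesgue_cball_translate)
  have fV: "(\<lambda>t. f (t + of_int m)) \<in> V"
    using closure_approx_in_L1(1)[of f _ "{}" 1] f
    unfolding shift_invariant_space_def by (intro translate_V) auto
  have q_AE: "q f = q g" if "f \<in> V" "g \<in> V" "AE t in lebesgue. t \<in> K \<longrightarrow> f t = g t" for f g
    unfolding q_def set_lebesgue_integral_def
    using norm_V[OF that(1)] norm_V[OF that(2)] that(3)
    unfolding set_integrable_def
    by (intro integral_cong_AE borel_measurable_integrable) (auto elim!: eventually_mono simp: indicator_def)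
  have "\<exists>h\<in>cfun.span (e ` P). q ((\<lambda>t. f (t + of_int m)) - h) < \<epsilon>" if \<epsilon>: "\<epsilon> > 0" for \<epsilon>
  proof -
    obtain g where g: "g \<in> integer_shift_sums n \<phi>" "g \<in> L1_loc"
      and close: "(LINT t:cball (a + of_int m) \<delta>|lebesgue. norm (g t - f t)) < \<epsilon>"
      using closure_approx_in_L1(2)[OF f[unfolded shift_invariant_space_def] compact_cball \<epsilon>] by blast
    obtain c where c: "g = (\<lambda>t. \<Sum>j=1..n. \<Sum>\<^sub>\<infinity>k::int. c j k * \<phi> j (t - of_int k))"
      using g(1) unfolding integer_shift_sums_def by blast
    define h where "h = (\<Sum>(j, l)\<in>P. cscale (c j (l + m)) (e (j, l)))"
    have h: "h \<in> cfun.span (e ` P)"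
      unfolding h_def by (intro cfun.span_sum) (auto intro!: cfun.span_scale[OF cfun.span_base])
    then have "h \<in> V" using cfun.span_minimal[OF eV V] by blast
    have "h t = (\<Sum>(j, l)\<in>P. c j (l + m) * \<phi> j (t - of_int l))" for t
      unfolding h_def sum_fun_at by (intro sum.cong) (auto simp: e_def cscale_def)
    then have "AE t in lebesgue. t \<in> K \<longrightarrow> g (t + of_int m) = h t"
      using shift_sum_on_window[OF P, of K c m] avoid unfolding c K_def by simp
    then have "q ((\<lambda>t. f (t + of_int m)) - h) =
        q ((\<lambda>t. f (t + of_int m)) - (\<lambda>t. g (t + of_int m)))"
      using fV translate_V[OF g(2)] \<open>h \<in> V\<close> cfun.subspace_diff[OF V]
      by (intro q_AE) (auto elim!: eventually_mono)
    also have "\<dots> = (LINT t:cball a \<delta>|lebesgue. norm (g (t + of_int m) - f (t + of_int m)))"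
      by (simp add: q_def K_def norm_minus_commute)
    also have "\<dots> = (LINT t:cball (a + of_int m) \<delta>|lebesgue. norm (g t - f t))"
      by (rule set_lebesgue_cball_translate(2)[of a \<delta> "\<lambda>t. norm (g t - f t)"])
    finally have "q ((\<lambda>t. f (t + of_int m)) - h) < \<epsilon>"
      using close by (simp only:)
    then show ?thesis using h by blast
  qed
  then obtain h where h: "h \<in> cfun.span (e ` P)" "q ((\<lambda>t. f (t + of_int m)) - h) = 0"
    using finite_span_closed_under_seminorm[OF V, of q "e ` P" "\<lambda>t. f (t + of_int m)"]
      q_nonneg q_tri q_scale P(2) eV fV by blast
  define d where "d = (\<lambda>t. f (t + of_int m)) - h"
  have "d \<in> V"
    unfolding d_def using fV h(1) cfun.span_minimal[OF eV V] cfun.subspace_diff[OF V] by blast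
  have "AE t in lebesgue. indicat_real K t *\<^sub>R norm (d t) = 0"
    using h(2) norm_V[OF \<open>d \<in> V\<close>]
    unfolding q_def d_def[symmetric] set_lebesgue_integral_def set_integrable_def
    by (subst (asm) integral_nonneg_eq_0_iff_AE) auto
  then have "AE t in lebesgue. t \<in> K \<longrightarrow> f (t + of_int m) = h t"
    by (rule eventually_mono) (auto simp: d_def indicator_def)
  then show ?thesis
    using h(1) unfolding K_def e_def by blast
qed

text \<open>Distinct nonzero \<open>z\<close> have logarithms that are distinct modulo \<open>2 pi i\<close>, since exponentiating recovers \<open>z\<close>.\<close>
lemma exp_poly_space_enumerate:
  assumes Z: "finite Z" "0 \<notin> Z" "Z \<noteq> {}"
  shows "\<exists>(s::nat) \<mu>. s \<ge> 1 \<and>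
    (\<forall>i\<in>{1..s}. \<forall>j\<in>{1..s}. i \<noteq> j \<longrightarrow>
      \<not> (\<exists>m::int. \<mu> i - \<mu> j = of_int m * (2 * of_real pi * \<i>))) \<and>
    (\<forall>f\<in>exp_poly_space Z D. \<exists>\<pi> :: nat \<Rightarrow> nat \<Rightarrow> real \<Rightarrow> complex.
      (\<forall>j k. \<pi> j k \<in> periodic_analytic) \<and>
      (\<forall>t. f t = (\<Sum>j=1..s. exp (\<mu> j * of_real t) * (\<Sum>k=0..D. \<pi> j k t * of_real t ^ k))))"
proof -
  obtain h where h: "bij_betw h {1..card Z} Z"
    using ex_bij_betw_nat_finite_1[OF Z(1)] by blast
  have hZ: "h i \<in> Z" if "i \<in> {1..card Z}" for i
    using h that bij_betwE by blast
  show ?thesis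
  proof (intro exI[of _ "card Z"] exI[of _ "\<lambda>i. Ln (h i)"] conjI ballI impI)
    show "card Z \<ge> 1" using Z(1,3) by (simp add: Suc_le_eq card_gt_0_iff)
  next
    fix i j assume ij: "i \<in> {1..card Z}" "j \<in> {1..card Z}" "i \<noteq> j"
    show "\<not> (\<exists>m::int. Ln (h i) - Ln (h j) = of_int m * (2 * of_real pi * \<i>))"
    proof
      assume "\<exists>m::int. Ln (h i) - Ln (h j) = of_int m * (2 * of_real pi * \<i>)"
      then obtain m :: int where "Ln (h i) = Ln (h j) + (of_int (2 * m) * pi) * \<i>"
        by (auto simp: algebra_simps)
      then have "exp (Ln (h i)) = exp (Ln (h j))"
        using exp_eq by blast
      moreover have "h i \<noteq> 0" "h j \<noteq> 0" using hZ ij Z(2) by metis+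
      ultimately have "h i = h j" by simp
      then show False using ij bij_betw_imp_inj_on[OF h] by (auto dest: inj_onD)
    qed
  next
    fix f assume "f \<in> exp_poly_space Z D"
    then obtain \<pi> where \<pi>: "\<And>z k. \<pi> z k \<in> periodic_analytic"
      and f: "f = (\<lambda>t. \<Sum>z\<in>Z. exp (Ln z * of_real t) * (\<Sum>k=0..D. \<pi> z k t * of_real t ^ k))"
      unfolding exp_poly_space_def by blast
    have "f t = (\<Sum>j=1..card Z. exp (Ln (h j) * of_real t) * (\<Sum>k=0..D. \<pi> (h j) k t * of_real t ^ k))" for t
      unfolding f by (rule sum.reindex_bij_betw[OF h, symmetric])
    then show "\<exists>\<pi> :: nat \<Rightarrow> nat \<Rightarrow> real \<Rightarrow> complex. (\<forall>j k. \<pi> j k \<in> periodic_analytic) \<and>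
      (\<forall>t. f t = (\<Sum>j=1..card Z. exp (Ln (h j) * of_real t) * (\<Sum>k=0..D. \<pi> j k t * of_real t ^ k)))"
      using \<pi> by (intro exI[of _ "\<lambda>j. \<pi> (h j)"]) auto
  qed
qed

theorem theorem2p7:
  fixes n :: nat and \<phi> :: "nat \<Rightarrow> real \<Rightarrow> complex" and H :: "(real \<Rightarrow> complex) set"
  assumes integrable: "\<And>j. j \<in> {1..n} \<Longrightarrow> integrable lebesgue (\<phi> j)"
    and compact_support: "\<And>j. j \<in> {1..n} \<Longrightarrow> compact (ess_support (\<phi> j))"
    and H: "H = {f \<in> shift_invariant_space n \<phi>. analytic_fun f}"
  shows "(\<exists>(s::nat) (\<mu>::nat \<Rightarrow> complex) (d::nat \<Rightarrow> nat).
            s \<ge> 1 \<and>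
            (\<forall>i\<in>{1..s}. \<forall>j\<in>{1..s}. i \<noteq> j \<longrightarrow>
               \<not> (\<exists>m::int. \<mu> i - \<mu> j = of_int m * (2 * of_real pi * \<i>))) \<and>
            (\<forall>f\<in>H. \<exists>\<pi> :: nat \<Rightarrow> nat \<Rightarrow> real \<Rightarrow> complex.
               (\<forall>j\<in>{1..s}. \<forall>k\<in>{0..d j}.
                  analytic_fun (\<pi> j k) \<and> (\<forall>t. \<pi> j k (t + 1) = \<pi> j k t)) \<and>
               (\<forall>t. f t = (\<Sum>j=1..s. exp (\<mu> j * of_real t) *
                              (\<Sum>k=0..d j. \<pi> j k t * of_real t ^ k)))))
       \<and> (\<exists>B. finite B \<and> H \<subseteq> cfun.span B)
       \<and> real (cfun.dim H) \<le> (\<Sum>j=1..n. measure lebesgue (ess_support (\<phi> j)))"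
proof -
  have compact: "\<forall>j\<in>{1..n}. compact (ess_support (\<phi> j))"
    using compact_support by blast
  obtain a :: real where fin: "finite {(j, k :: int). j \<in> {1..n} \<and> a - of_int k \<in> ess_support (\<phi> j)}"
    and card: "real (card {(j, k :: int). j \<in> {1..n} \<and> a - of_int k \<in> ess_support (\<phi> j)}) \<le>
      (\<Sum>j=1..n. measure lebesgue (ess_support (\<phi> j)))"
    using exists_point_in_few_translates[OF _ compact] by auto
  obtain \<delta> where \<delta>: "\<delta> > 0" and avoid: "\<And>j k t. j \<in> {1..n} \<Longrightarrow> a - of_int k \<notin> ess_support (\<phi> j) \<Longrightarrow>
      t \<in> cball a \<delta> \<Longrightarrow> t - of_int k \<notin> ess_support (\<phi> j)"
    using avoided_translates_locally_avoided[OF _ compact, of a] by auto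
  define P where "P = {(j, k :: int). j \<in> {1..n} \<and> a - of_int k \<in> ess_support (\<phi> j)}"
  define B where "B = (\<lambda>(j, k) t. \<phi> j (t - of_int k)) ` P"
  have B: "finite B" "card B \<le> card P"
    using fin by (simp_all add: B_def P_def card_image_le)
  define N :: "(real \<Rightarrow> complex) set" where "N = {f. AE t in lebesgue. t \<in> cball a \<delta> \<longrightarrow> f t = 0}"
  have N: "cfun.subspace N"
  proof (rule cfun.subspaceI)
    show "f + g \<in> N" if "f \<in> N" "g \<in> N" for f g
      using that unfolding N_def mem_Collect_eq by eventually_elim simp
    show "cscale c f \<in> N" if "f \<in> N" for c f
      using that unfolding N_def mem_Collect_eq by eventually_elim (simp add: cscale_def)
  qed (simp add: N_def)
  \<comment> \<open>\<open>G\<close> stands in for the space of analytic functions in the shift-invariant space: linearity and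
    invariance under translation are immediate from its definition, without recourse to the topology.\<close>
  define G where "G = {f. analytic_fun f \<and> (\<forall>m::nat. \<exists>h\<in>cfun.span B. (\<lambda>t. f (t + of_nat m)) - h \<in> N)}"
  have "H \<subseteq> G"
  proof
    fix f assume f: "f \<in> H"
    then have fS: "f \<in> shift_invariant_space n \<phi>" and fA: "analytic_fun f"
      by (simp_all add: H)
    have "\<exists>h\<in>cfun.span B. (\<lambda>t. f (t + of_nat m)) - h \<in> N" for m
    proof -
      have "\<exists>h\<in>cfun.span B. AE t in lebesgue. t \<in> cball a \<delta> \<longrightarrow> f (t + of_int (int m)) = h t"
        unfolding B_def
        by (rule shift_invariant_space_on_window[OF fS integrable P_def fin[folded P_def] avoid])
      then show ?thesis
        by (simp add: N_def)
    qed
    then show "f \<in> G"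
      unfolding G_def using fA by blast
  qed
  have G: "cfun.subspace G"
  proof (rule cfun.subspaceI)
    have "(\<lambda>t. (0 :: real \<Rightarrow> complex) (t + of_nat m)) - 0 \<in> N" for m
      using cfun.subspace_0[OF N] by (simp add: zero_fun_def fun_diff_def)
    moreover have "analytic_fun 0"
      using analytic_fun_const[of 0] by (simp add: zero_fun_def)
    ultimately show "0 \<in> G"
      unfolding G_def using cfun.span_zero by blast
  next
    fix f g assume fg: "f \<in> G" "g \<in> G"
    have "\<exists>h\<in>cfun.span B. (\<lambda>t. (f + g) (t + of_nat m)) - h \<in> N" for m
    proof -
      obtain h h' where *: "h \<in> cfun.span B" "(\<lambda>t. f (t + of_nat m)) - h \<in> N"
        "h' \<in> cfun.span B" "(\<lambda>t. g (t + of_nat m)) - h' \<in> N"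
        using fg unfolding G_def by blast
      have "(\<lambda>t. (f + g) (t + of_nat m)) - (h + h') =
          ((\<lambda>t. f (t + of_nat m)) - h) + ((\<lambda>t. g (t + of_nat m)) - h')"
        by (simp add: fun_eq_iff)
      then show ?thesis
        using cfun.subspace_add[OF N *(2,4)] cfun.span_add[OF *(1,3)] by metis
    qed
    moreover have "analytic_fun (f + g)"
      using fg analytic_fun_add[of f g] by (simp add: G_def plus_fun_def)
    ultimately show "f + g \<in> G"
      unfolding G_def by blast
  next
    fix c f assume f: "f \<in> G"
    have "\<exists>h\<in>cfun.span B. (\<lambda>t. cscale c f (t + of_nat m)) - h \<in> N" for m
    proof -
      obtain h where *: "h \<in> cfun.span B" "(\<lambda>t. f (t + of_nat m)) - h \<in> N"
        using f unfolding G_def by blast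
      have "(\<lambda>t. cscale c f (t + of_nat m)) - cscale c h = cscale c ((\<lambda>t. f (t + of_nat m)) - h)"
        by (simp add: fun_eq_iff cscale_def algebra_simps)
      then show ?thesis
        using cfun.subspace_scale[OF N *(2)] cfun.span_scale[OF *(1)] by metis
    qed
    moreover have "analytic_fun (cscale c f)"
      using f analytic_fun_cmult[of f c] by (simp add: G_def cscale_def)
    ultimately show "cscale c f \<in> G"
      unfolding G_def by blast
  qed
  have G_shift: "(\<lambda>t. f (t + 1)) \<in> G" if f: "f \<in> G" for f
  proof -
    have "\<exists>h\<in>cfun.span B. (\<lambda>t. f (t + of_nat m + 1)) - h \<in> N" for m
    proof -
      have "\<exists>h\<in>cfun.span B. (\<lambda>t. f (t + of_nat (Suc m))) - h \<in> N"
        using f unfolding G_def by blast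
      then show ?thesis by (simp add: add_ac)
    qed
    moreover have "analytic_fun (\<lambda>t. f (t + 1))"
      using f analytic_fun_shift by (simp add: G_def)
    ultimately show ?thesis
      unfolding G_def by blast
  qed
  have "f = 0" if "f \<in> G" "f \<in> N" for f
    using analytic_fun_eq_0_if_AE[OF _ \<delta>, of f a] that by (simp add: G_def N_def zero_fun_def)
  then have "G \<inter> N \<subseteq> {0}" by blast
  moreover have "\<exists>h\<in>cfun.span B. f - h \<in> N" if "f \<in> G" for f
  proof -
    have "\<exists>h\<in>cfun.span B. (\<lambda>t. f (t + of_nat 0)) - h \<in> N"
      using that unfolding G_def by blast
    then show ?thesis by simp
  qed
  ultimately obtain C where C: "finite C" "card C \<le> card B" "G \<subseteq> cfun.span C"
    using subspace_spanned_by_card[OF B(1) G N] by blast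
  obtain p where p: "p \<noteq> 0" "\<And>f. f \<in> G \<Longrightarrow> poly_shift p f = 0"
    using shift_invariant_finite_dim_annihilated[OF G_shift C(1,3)] by blast
  obtain Z D where Z: "finite Z" "0 \<notin> Z"
    and form: "\<And>f. analytic_fun f \<Longrightarrow> poly_shift p f = (\<lambda>t. 0) \<Longrightarrow> f \<in> exp_poly_space Z D"
    using annihilated_by_shift_poly_imp_exp_poly[OF p(1)] by blast
  \<comment> \<open>The exponent \<open>Ln 1 = 0\<close> is added so that \<open>Z\<close> is nonempty even when \<open>p\<close> has no nonzero root.\<close>
  have mem: "f \<in> exp_poly_space (insert 1 Z) D" if "f \<in> H" for f
  proof -
    have "f \<in> G" using that \<open>H \<subseteq> G\<close> by blast
    then have "f \<in> exp_poly_space Z D"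
      using p(2)[of f] by (intro form) (simp_all add: G_def zero_fun_def)
    then show ?thesis
      using exp_poly_space_mono[of "insert 1 Z" Z D D] Z(1) by blast
  qed
  have Z1: "finite (insert 1 Z)" "0 \<notin> insert 1 Z" "insert 1 Z \<noteq> {}"
    using Z by auto
  obtain s \<mu> where s: "s \<ge> 1"
    "\<forall>i\<in>{1..s}. \<forall>j\<in>{1..s}. i \<noteq> j \<longrightarrow>
      \<not> (\<exists>m::int. \<mu> i - \<mu> j = of_int m * (2 * of_real pi * \<i>))"
    and s_rep: "\<forall>f\<in>exp_poly_space (insert 1 Z) D. \<exists>\<pi> :: nat \<Rightarrow> nat \<Rightarrow> real \<Rightarrow> complex.
      (\<forall>j k. \<pi> j k \<in> periodic_analytic) \<and>
      (\<forall>t. f t = (\<Sum>j=1..s. exp (\<mu> j * of_real t) * (\<Sum>k=0..D. \<pi> j k t * of_real t ^ k)))"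
    using exp_poly_space_enumerate[OF Z1, of D] by (elim exE conjE) (rule that)
  have rep: "\<exists>\<pi> :: nat \<Rightarrow> nat \<Rightarrow> real \<Rightarrow> complex.
      (\<forall>j\<in>{1..s}. \<forall>k\<in>{0..D}. analytic_fun (\<pi> j k) \<and> (\<forall>t. \<pi> j k (t + 1) = \<pi> j k t)) \<and>
      (\<forall>t. f t = (\<Sum>j=1..s. exp (\<mu> j * of_real t) * (\<Sum>k=0..D. \<pi> j k t * of_real t ^ k)))"
    if f: "f \<in> H" for f
  proof -
    obtain \<pi> where \<pi>: "\<forall>j k. \<pi> j k \<in> periodic_analytic"
      "\<forall>t. f t = (\<Sum>j=1..s. exp (\<mu> j * of_real t) * (\<Sum>k=0..D. \<pi> j k t * of_real t ^ k))"
      using bspec[OF s_rep mem[OF f]] by (elim exE conjE) (rule that)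
    have "analytic_fun (\<pi> j k) \<and> (\<forall>t. \<pi> j k (t + 1) = \<pi> j k t)" for j k
      using \<pi>(1) unfolding periodic_analytic_def by blast
    then show ?thesis
      using \<pi>(2) by (intro exI[of _ \<pi>]) blast
  qed
  have "H \<subseteq> cfun.span C" using \<open>H \<subseteq> G\<close> C(3) by blast
  then have "cfun.dim H \<le> card P"
    using cfun.dim_le_card[of H C] C(1,2) B(2) by simp
  then have "real (cfun.dim H) \<le> (\<Sum>j=1..n. measure lebesgue (ess_support (\<phi> j)))"
    using card unfolding P_def by (meson of_nat_le_iff order_trans)
  moreover have "\<exists>B. finite B \<and> H \<subseteq> cfun.span B"
    using C(1) \<open>H \<subseteq> cfun.span C\<close> by blast
  ultimately show ?thesis
    using s rep by (intro conjI exI[of _ s] exI[of _ \<mu>] exI[of _ "\<lambda>_. D"] ballI) simp_all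
qed

end
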